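(* Let $p$ be an odd prime, $D_{2p}=\langle \tau,\sigma\mid \tau^p=\sigma^2=e,\ \sigma\tau\sigma=\tau^{-1}\rangle$, and for $0\le k\le 2p-1$ let $\mathcal{M}_k$ be the number of Cayley digraphs on $D_{2p}$ of out-degree $k$ (i.e. $\mathrm{Cay}(D_{2p},S)$ with $|S|=k$) up to isomorphism. Then $\mathcal{M}_k=1$ if $k=0$ or $k=2p-1$; $$\mathcal{M}_k=\frac{1}{p}\left[\binom{p-1}{k}-\binom{2p-1}{k}\right]+\mathcal{M}_k^1\quad\text{if }1\le k\le p-1;$$ $$\mathcal{M}_k=\frac{1}{p}\left[\binom{p-1}{k-p}-\binom{2p-1}{k}\right]+\mathcal{M}_k^1\quad\text{if }p\le k\le 2p-2;$$ where $$\mathcal{M}_k^1=\frac{1}{p-1}\left[\sum_{d\mid\gcd(p-1,k)}\Phi(d)\binom{\frac{2(p-1)}{d}}{\frac{k}{d}}+\sum_{d\mid\gcd(p-1,k-1)}\Phi(d)\binom{\frac{2(p-1)}{d}}{\frac{k-1}{d}}\right]$$ and $\Phi$ is Euler's totient function.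
   Context: For a finite group $G$ and $S\subseteq G$ with $e\notin S$, the Cayley digraph $\mathrm{Cay}(G,S)$ has vertex set $G$ and an arc from $g$ to $h$ whenever $hg^{-1}\in S$; its out-degree is $|S|$. Note $\gcd(n,0)=n$. *)

theory Defs
  imports
    Complex_Main
    "HOL-Algebra.Group"
    "HOL-Algebra.Coset"
    "HOL-Number_Theory.Totient"
    "Graph_Theory.Digraph_Isomorphism"
begin

section \<open>Groups given by generators and relations\<close>

text \<open>
  A word is a list of letters \<^term>\<open>(x, b)\<close>, standing for the generator \<^term>\<open>x\<close> if
  \<^term>\<open>b\<close> is true and for its formal inverse otherwise. The generators are all the elements of
  the type \<^typ>\<open>'a\<close>, and a pair \<^term>\<open>(u, v)\<close> in \<^term>\<open>R\<close> is the defining relation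
  \<open>u = v\<close>.
\<close>

type_synonym 'a group_word = "('a \<times> bool) list"

inductive word_eq :: "('a group_word \<times> 'a group_word) set \<Rightarrow> 'a group_word \<Rightarrow> 'a group_word \<Rightarrow> bool"
  for R where
  relation: "(u, v) \<in> R \<Longrightarrow> word_eq R u v"
| cancel: "word_eq R [(x, b), (x, \<not> b)] []"
| append: "word_eq R u u' \<Longrightarrow> word_eq R v v' \<Longrightarrow> word_eq R (u @ v) (u' @ v')"
| refl: "word_eq R u u"
| sym: "word_eq R u v \<Longrightarrow> word_eq R v u"
| trans: "word_eq R u v \<Longrightarrow> word_eq R v w \<Longrightarrow> word_eq R u w"

definition word_class :: "('a group_word \<times> 'a group_word) set \<Rightarrow> 'a group_word \<Rightarrow> 'a group_word set"
  where "word_class R u = {v. word_eq R u v}"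

definition presented_group ::
    "('a group_word \<times> 'a group_word) set \<Rightarrow> 'a group_word set monoid" where
  "presented_group R =
    \<lparr>carrier = range (word_class R),
     monoid.mult = (\<lambda>A B. \<Union>u\<in>A. \<Union>v\<in>B. word_class R (u @ v)),
     one = word_class R []\<rparr>"

lemma word_class_eq_iff: "word_class R u = word_class R v \<longleftrightarrow> word_eq R u v"
proof
  assume "word_class R u = word_class R v"
  then have "v \<in> word_class R u" by (simp add: word_class_def word_eq.refl)
  then show "word_eq R u v" by (simp add: word_class_def)
next
  assume "word_eq R u v"
  then have "word_eq R u w \<longleftrightarrow> word_eq R v w" for w
    by (meson word_eq.sym word_eq.trans)
  then show "word_class R u = word_class R v" by (simp add: word_class_def)
qed

lemma presented_group_simps:
  "carrier (presented_group R) = range (word_class R)"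
  "\<one>\<^bsub>presented_group R\<^esub> = word_class R []"
  "word_class R u \<otimes>\<^bsub>presented_group R\<^esub> word_class R v = word_class R (u @ v)"
proof -
  have "word_class R (u' @ v') = word_class R (u @ v)"
    if "u' \<in> word_class R u" "v' \<in> word_class R v" for u' v'
    using that unfolding word_class_eq_iff
    by (simp add: word_class_def word_eq.append word_eq.sym)
  then have "(\<Union>u'\<in>word_class R u. \<Union>v'\<in>word_class R v. word_class R (u' @ v')) =
      (\<Union>u'\<in>word_class R u. \<Union>v'\<in>word_class R v. word_class R (u @ v))"
    by (intro SUP_cong) (rule HOL.refl | assumption)+
  moreover have "u \<in> word_class R u" "v \<in> word_class R v"
    by (simp_all add: word_class_def word_eq.refl)
  ultimately show "word_class R u \<otimes>\<^bsub>presented_group R\<^esub> word_class R v = word_class R (u @ v)"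
    unfolding presented_group_def by (simp only: monoid.simps) blast
qed (simp_all add: presented_group_def)

definition word_inv :: "'a group_word \<Rightarrow> 'a group_word" where
  "word_inv u = rev (map (\<lambda>(x, b). (x, \<not> b)) u)"

lemma word_eq_inv: "word_eq R (word_inv u @ u) []"
proof (induction u)
  case Nil
  show ?case by (simp add: word_inv_def word_eq.refl)
next
  case (Cons a u)
  obtain x b where a: "a = (x, b)" by fastforce
  have "word_eq R (word_inv u @ ([(x, \<not> b), (x, b)] @ u)) (word_inv u @ ([] @ u))"
    using word_eq.cancel[of R x "\<not> b"] by (intro word_eq.append word_eq.refl) simp
  then show ?case using Cons a by (simp add: word_inv_def) (meson word_eq.trans)
qed

lemma group_presented_group: "group (presented_group R)"
proof (rule groupI)
  fix A assume "A \<in> carrier (presented_group R)"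
  then obtain u where u: "A = word_class R u" by (auto simp: presented_group_simps)
  have "word_class R (word_inv u) \<otimes>\<^bsub>presented_group R\<^esub> A = \<one>\<^bsub>presented_group R\<^esub>"
    by (simp add: u presented_group_simps word_class_eq_iff word_eq_inv)
  then show "\<exists>B\<in>carrier (presented_group R). B \<otimes>\<^bsub>presented_group R\<^esub> A = \<one>\<^bsub>presented_group R\<^esub>"
    by (auto simp: presented_group_simps(1))
qed (auto simp: presented_group_simps)


section \<open>The dihedral group\<close>

datatype dihedral_gen = Gen_tau | Gen_sigma

definition dihedral_relations :: "nat \<Rightarrow> (dihedral_gen group_word \<times> dihedral_gen group_word) set" where
  "dihedral_relations n =
    {(replicate n (Gen_tau, True), []),
     ([(Gen_sigma, True), (Gen_sigma, True)], []),
     ([(Gen_sigma, True), (Gen_tau, True), (Gen_sigma, True)], [(Gen_tau, False)])}"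

text \<open>The argument is half of the order: the group \<open>D\<^sub>2\<^sub>p\<close> of order \<open>2p\<close> is \<open>dihedral_group p\<close>.\<close>

definition dihedral_group :: "nat \<Rightarrow> dihedral_gen group_word set monoid" where
  "dihedral_group n = presented_group (dihedral_relations n)"

lemma group_dihedral_group: "group (dihedral_group n)"
  by (simp add: dihedral_group_def group_presented_group)

text \<open>
  The value of a word in the infinite dihedral group \<open>\<int> \<rtimes> {1, -1}\<close>; it is used to separate the
  normal forms.
\<close>

primrec dihedral_val :: "dihedral_gen group_word \<Rightarrow> int \<times> int" where
  "dihedral_val [] = (0, 1)"
| "dihedral_val (a # u) = (case dihedral_val u of (i, s) \<Rightarrow>
     (case a of (Gen_tau, b) \<Rightarrow> (if b then i + 1 else i - 1, s) | (Gen_sigma, b) \<Rightarrow> (- i, - s)))"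

lemma dihedral_val_append:
  "dihedral_val (u @ v) =
    (fst (dihedral_val u) + snd (dihedral_val u) * fst (dihedral_val v),
     snd (dihedral_val u) * snd (dihedral_val v))"
  by (induction u) (auto split: prod.splits dihedral_gen.splits)

lemma dihedral_val_replicate:
  "dihedral_val (replicate i (Gen_tau, True)) = (int i, 1)"
  "dihedral_val (replicate j (Gen_sigma, True)) = (0, (- 1) ^ j)"
proof -
  show "dihedral_val (replicate i (Gen_tau, True)) = (int i, 1)" by (induction i) auto
  show "dihedral_val (replicate j (Gen_sigma, True)) = (0, (- 1) ^ j)" by (induction j) auto
qed

lemma dihedral_val_word_eq:
  assumes "word_eq (dihedral_relations n) u v"
  shows "[fst (dihedral_val u) = fst (dihedral_val v)] (mod int n) \<and>
    snd (dihedral_val u) = snd (dihedral_val v)"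
  using assms
proof induction
  case (relation u v)
  then show ?case
    by (auto simp: dihedral_relations_def dihedral_val_replicate cong_def)
next
  case (cancel x b)
  then show ?case by (cases x) auto
next
  case (append u u' v v')
  then show ?case by (simp add: dihedral_val_append cong_add cong_mult)
next
  case (sym u v)
  then show ?case by (simp add: cong_sym)
next
  case (trans u v w)
  then show ?case by (metis cong_trans)
qed simp

abbreviation dihedral_nf :: "nat \<Rightarrow> nat \<Rightarrow> dihedral_gen group_word" where
  "dihedral_nf i j \<equiv> replicate i (Gen_tau, True) @ replicate j (Gen_sigma, True)"

context
  fixes n :: nat
  assumes n: "n > 0"
begin

private abbreviation weq (infix \<open>\<approx>\<close> 50) where "u \<approx> v \<equiv> word_eq (dihedral_relations n) u v"
private abbreviation tpow where "tpow i \<equiv> replicate i (Gen_tau, True)"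

private lemma pre: "u \<approx> v \<Longrightarrow> w @ u \<approx> w @ v"
  by (intro word_eq.append word_eq.refl)

private lemma post: "u \<approx> v \<Longrightarrow> u @ w \<approx> v @ w"
  by (intro word_eq.append word_eq.refl)

private lemma tpow_n: "tpow n \<approx> []" and sigma2: "[(Gen_sigma, True), (Gen_sigma, True)] \<approx> []"
  and conj: "[(Gen_sigma, True), (Gen_tau, True), (Gen_sigma, True)] \<approx> [(Gen_tau, False)]"
  by (auto intro!: word_eq.relation simp: dihedral_relations_def)

private lemma tau_inv: "[(Gen_tau, False)] \<approx> tpow (n - 1)"
proof -
  have eq: "tpow n = [(Gen_tau, True)] @ tpow (n - 1)"
    using n by (cases n) auto
  have "[(Gen_tau, False)] @ tpow n \<approx> [(Gen_tau, False)] @ []" by (rule pre[OF tpow_n])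
  moreover have "([(Gen_tau, False)] @ [(Gen_tau, True)]) @ tpow (n - 1) \<approx> [] @ tpow (n - 1)"
    using word_eq.cancel[of "dihedral_relations n" Gen_tau False] by (intro post) simp
  ultimately show ?thesis
    unfolding eq by simp (meson word_eq.trans word_eq.sym)
qed

private lemma sigma_inv: "[(Gen_sigma, False)] \<approx> [(Gen_sigma, True)]"
proof -
  have "[(Gen_sigma, False)] @ [(Gen_sigma, True), (Gen_sigma, True)] \<approx> [(Gen_sigma, False)] @ []"
    by (rule pre[OF sigma2])
  moreover have "[(Gen_sigma, False), (Gen_sigma, True)] @ [(Gen_sigma, True)] \<approx> [] @ [(Gen_sigma, True)]"
    using word_eq.cancel[of "dihedral_relations n" Gen_sigma False] by (intro post) simp
  ultimately show ?thesis
    by simp (meson word_eq.trans word_eq.sym)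
qed

private lemma sigma_tau: "[(Gen_sigma, True)] @ [(Gen_tau, True)] \<approx> tpow (n - 1) @ [(Gen_sigma, True)]"
proof -
  have "[(Gen_sigma, True), (Gen_tau, True)] @ [(Gen_sigma, True), (Gen_sigma, True)] \<approx> [(Gen_sigma, True), (Gen_tau, True)] @ []"
    by (rule pre[OF sigma2])
  moreover have "[(Gen_sigma, True), (Gen_tau, True), (Gen_sigma, True)] @ [(Gen_sigma, True)]
      \<approx> tpow (n - 1) @ [(Gen_sigma, True)]"
    by (rule post) (rule word_eq.trans[OF conj tau_inv])
  ultimately show ?thesis
    by simp (meson word_eq.trans word_eq.sym)
qed

private lemma sigma_tpow: "[(Gen_sigma, True)] @ tpow i \<approx> tpow (i * (n - 1)) @ [(Gen_sigma, True)]"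
proof (induction i)
  case 0
  show ?case by (simp add: word_eq.refl)
next
  case (Suc i)
  have "([(Gen_sigma, True)] @ [(Gen_tau, True)]) @ tpow i \<approx> (tpow (n - 1) @ [(Gen_sigma, True)]) @ tpow i"
    by (rule post[OF sigma_tau])
  moreover have "tpow (n - 1) @ ([(Gen_sigma, True)] @ tpow i)
      \<approx> tpow (n - 1) @ (tpow (i * (n - 1)) @ [(Gen_sigma, True)])"
    by (rule pre[OF Suc.IH])
  ultimately show ?case
    by (simp add: replicate_add) (meson word_eq.trans)
qed

private lemma tpow_mod: "tpow i \<approx> tpow (i mod n)"
proof (induction i rule: less_induct)
  case (less i)
  show ?case
  proof (cases "i < n")
    case True
    then show ?thesis by (simp add: word_eq.refl)
  next
    case False
    then have "tpow i = tpow n @ tpow (i - n)" by (simp flip: replicate_add)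
    then have "tpow i \<approx> [] @ tpow (i - n)" by (simp only: post[OF tpow_n])
    moreover have "tpow (i - n) \<approx> tpow ((i - n) mod n)" using less n False by simp
    moreover have "(i - n) mod n = i mod n" using False by (simp add: le_mod_geq)
    ultimately show ?thesis by simp (meson word_eq.trans)
  qed
qed

private lemma nf_exists: "\<exists>i j. i < n \<and> j < 2 \<and> u \<approx> dihedral_nf i j"
proof (induction u)
  case Nil
  show ?case using n by (intro exI[of _ 0]) (simp add: word_eq.refl)
next
  case (Cons a u)
  then obtain i j where ij: "j < 2" "u \<approx> dihedral_nf i j" by blast
  have "\<exists>i' j'. j' < 2 \<and> [a] @ dihedral_nf i j \<approx> dihedral_nf i' j'"
  proof -
    consider "a = (Gen_tau, True)" | "a = (Gen_tau, False)" | "a = (Gen_sigma, True) \<or> a = (Gen_sigma, False)"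
      by (cases a, cases "fst a"; cases "snd a") auto
    then show ?thesis
    proof cases
      case 1
      then show ?thesis using ij(1)
        by (intro exI[of _ "Suc i"] exI[of _ j]) (simp add: word_eq.refl)
    next
      case 2
      have "[(Gen_tau, False)] @ dihedral_nf i j \<approx> tpow (n - 1) @ dihedral_nf i j"
        by (rule post[OF tau_inv])
      then show ?thesis using ij(1) 2
        by (intro exI[of _ "n - 1 + i"] exI[of _ j]) (simp add: replicate_add)
    next
      case 3
      have "[a] \<approx> [(Gen_sigma, True)]" using 3 sigma_inv by (auto intro: word_eq.refl)
      then have "[a] @ dihedral_nf i j \<approx> [(Gen_sigma, True)] @ dihedral_nf i j" by (rule post)
      moreover have "([(Gen_sigma, True)] @ tpow i) @ replicate j (Gen_sigma, True)
        \<approx> (tpow (i * (n - 1)) @ [(Gen_sigma, True)]) @ replicate j (Gen_sigma, True)"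
        by (rule post[OF sigma_tpow])
      ultimately have *: "[a] @ dihedral_nf i j \<approx> tpow (i * (n - 1)) @ replicate (Suc j) (Gen_sigma, True)"
        by simp (meson word_eq.trans)
      show ?thesis
      proof (cases "j = 0")
        case True
        then show ?thesis using * by (intro exI[of _ "i * (n - 1)"] exI[of _ 1]) simp
      next
        case False
        then have "j = 1" using ij(1) by simp
        then have "tpow (i * (n - 1)) @ replicate (Suc j) (Gen_sigma, True) \<approx> tpow (i * (n - 1)) @ []"
          using sigma2 by (intro pre) simp
        then show ?thesis using *
          by (intro exI[of _ "i * (n - 1)"] exI[of _ 0]) (simp, meson word_eq.trans)
      qed
    qed
  qed
  then obtain i' j' where ij': "j' < 2" "[a] @ dihedral_nf i j \<approx> dihedral_nf i' j'" by blast
  have "[a] @ u \<approx> [a] @ dihedral_nf i j" by (rule pre[OF ij(2)])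
  moreover have "dihedral_nf i' j' \<approx> dihedral_nf (i' mod n) j'" by (rule post[OF tpow_mod])
  ultimately have "a # u \<approx> dihedral_nf (i' mod n) j'"
    using ij'(2) by simp (meson word_eq.trans)
  then show ?case using ij'(1) n by (metis mod_less_divisor)
qed

lemma dihedral_group_bij_betw:
  "bij_betw (\<lambda>(i, j). word_class (dihedral_relations n) (dihedral_nf i j))
    ({..<n} \<times> {..<2}) (carrier (dihedral_group n))"
proof (rule bij_betw_imageI)
  show "inj_on (\<lambda>(i, j). word_class (dihedral_relations n) (dihedral_nf i j)) ({..<n} \<times> {..<2})"
  proof (rule inj_onI, clarify)
    fix i j i' j' :: nat
    assume lt: "i < n" "i' < n" "j < 2" "j' < 2"
      and "word_class (dihedral_relations n) (dihedral_nf i j) =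
        word_class (dihedral_relations n) (dihedral_nf i' j')"
    then have "[int i = int i'] (mod int n)" "(- 1 :: int) ^ j = (- 1) ^ j'"
      by (auto dest!: dihedral_val_word_eq
          simp: word_class_eq_iff dihedral_val_append dihedral_val_replicate)
    then show "i = i' \<and> j = j'"
      using lt by (auto simp: cong_def less_2_cases_iff)
  qed
  show "(\<lambda>(i, j). word_class (dihedral_relations n) (dihedral_nf i j)) ` ({..<n} \<times> {..<2})
    = carrier (dihedral_group n)"
  proof -
    have "\<exists>i<n. \<exists>j<2. word_class (dihedral_relations n) u =
        word_class (dihedral_relations n) (dihedral_nf i j)" for u
      using nf_exists[of u] by (auto simp: word_class_eq_iff)
    then show ?thesis
      by (fastforce simp: dihedral_group_def presented_group_simps image_iff)
  qed
qed

lemma order_dihedral_group: "order (dihedral_group n) = 2 * n"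
  using bij_betw_same_card[OF dihedral_group_bij_betw] by (simp add: order_def)

lemma finite_carrier_dihedral_group: "finite (carrier (dihedral_group n))"
  using bij_betw_finite[OF dihedral_group_bij_betw] by simp

end


section \<open>Cayley digraphs and their isomorphism classes\<close>

definition cayley_digraph :: "('a, 'b) monoid_scheme \<Rightarrow> 'a set \<Rightarrow> ('a, 'a \<times> 'a) pre_digraph" where
  "cayley_digraph G S =
    \<lparr>verts = carrier G,
     arcs = {(g, h). g \<in> carrier G \<and> h \<in> carrier G \<and> h \<otimes>\<^bsub>G\<^esub> inv\<^bsub>G\<^esub> g \<in> S},
     tail = fst, head = snd\<rparr>"

definition cayley_digraphs :: "('a, 'b) monoid_scheme \<Rightarrow> nat \<Rightarrow> ('a, 'a \<times> 'a) pre_digraph set" where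
  "cayley_digraphs G k =
    {cayley_digraph G S | S. S \<subseteq> carrier G \<and> \<one>\<^bsub>G\<^esub> \<notin> S \<and> card S = k}"

definition iso_classes :: "('a, 'b) pre_digraph set \<Rightarrow> ('a, 'b) pre_digraph set set" where
  "iso_classes A = A // {(X, Y). X \<in> A \<and> Y \<in> A \<and> digraph_iso X Y}"

lemma wf_cayley_digraph: "wf_digraph (cayley_digraph G S)"
  by unfold_locales (auto simp: cayley_digraph_def)

lemma equiv_digraph_iso:
  assumes "\<And>X. X \<in> A \<Longrightarrow> wf_digraph X"
  shows "equiv A {(X, Y). X \<in> A \<and> Y \<in> A \<and> digraph_iso X Y}"
proof (rule equivI)
  have "digraph_iso X X" if "wf_digraph X" for X :: "('a, 'b) pre_digraph"
    unfolding digraph_iso_def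
    by (rule exI[of _ "\<lparr>iso_verts = id, iso_arcs = id, iso_head = head X, iso_tail = tail X\<rparr>"])
      (simp add: that pre_digraph.digraph_isomorphism_def app_iso_def)
  then show "refl_on A {(X, Y). X \<in> A \<and> Y \<in> A \<and> digraph_iso X Y}"
    using assms by (auto simp: refl_on_def)
  show "sym {(X, Y). X \<in> A \<and> Y \<in> A \<and> digraph_iso X Y}"
    using assms by (auto simp: sym_def intro: digraph_iso_swap)
  show "trans {(X, Y). X \<in> A \<and> Y \<in> A \<and> digraph_iso X Y}"
    by (auto simp: trans_def intro: digraph_iso_trans)
qed auto

lemma finite_cayley_digraphs:
  assumes "finite (carrier G)"
  shows "finite (cayley_digraphs G k)"
proof (rule finite_subset)
  show "cayley_digraphs G k \<subseteq> cayley_digraph G ` Pow (carrier G)"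
    by (auto simp: cayley_digraphs_def)
qed (simp add: assms)

definition num_dihedral_cayley :: "nat \<Rightarrow> nat \<Rightarrow> nat" where
  "num_dihedral_cayley p k = card (iso_classes (cayley_digraphs (dihedral_group p) k))"

text \<open>
  The correction term for \<open>k \<ge> 1\<close>. All the natural number divisions below are exact.
\<close>

definition M1 :: "nat \<Rightarrow> nat \<Rightarrow> real" where
  "M1 p k = 1 / real (p - 1) *
    ((\<Sum>d | d dvd gcd (p - 1) k. real (totient d) * real ((2 * (p - 1) div d) choose (k div d))) +
     (\<Sum>d | d dvd gcd (p - 1) (k - 1).
        real (totient d) * real ((2 * (p - 1) div d) choose ((k - 1) div d))))"

end

theory Submission
  imports
    Defs
    "HOL-Algebra.Group_Action"
    "HOL-Combinatorics.Permutations"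
    "HOL-Number_Theory.Residue_Primitive_Roots"
begin

text \<open>
  The group \<open>D\<^sub>2\<^sub>p\<close> has the Cayley isomorphism property: isomorphic Cayley digraphs have connection
  sets that are conjugate under a group automorphism. To see this, let pairs of translations act on
  the set of isomorphisms by composition on both sides. The orbit of an isomorphism has \<open>p\<^sup>2\<close>
  elements unless the isomorphism normalizes the group of translations, so a normalizing isomorphism
  exists as soon as \<open>p\<^sup>2\<close> does not divide the number of normalizing automorphisms; and normalizing
  isomorphisms are affine, hence come from group automorphisms. The divisibility can only hold if the
  connection set contains all reflections or none. Up to complementation the digraph is then a
  disjoint union of two copies of a circulant digraph of order \<open>p\<close>, where the same counting argument
  always applies.

  Therefore the isomorphism classes are the orbits of the affine group \<open>AGL(1, p)\<close>, the automorphism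
  group of \<open>D\<^sub>2\<^sub>p\<close>, on the \<open>k\<close>-subsets of the non-identity elements, and Burnside's lemma gives the
  formula: translations contribute the binomials in \<open>p - 1\<close>, and the elements with multiplier of
  order \<open>d > 1\<close>, which fix one reflection and otherwise have cycles of length \<open>d\<close>, contribute to
  \<open>M1\<close>.
\<close>

section \<open>Isomorphisms normalizing the translations\<close>

locale prime_modulus =
  fixes p :: nat
  assumes prime_p: "prime p"
begin

definition Zp :: "int set" where "Zp = {0..<int p}"

text \<open>The second component names the translation orbits, called layers below: type
  \<open>unit\<close> gives the single layer of a circulant digraph, \<open>bool\<close> the
  rotations and the reflections. One counting argument thus serves both.\<close>

definition V :: "(int \<times> 'b::finite) set" where "V = Zp \<times> UNIV"

text \<open>Fixing every point outside \<open>V\<close> makes this a permutation in the sense of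
  \<open>permutes\<close>. As in \<open>isos\<close>, the maps are then determined by their values
  on the finite set \<open>V\<close>.\<close>

definition shift :: "int \<Rightarrow> int \<times> 'b::finite \<Rightarrow> int \<times> 'b" where
  "shift i v = (if fst v \<in> Zp then ((fst v + i) mod int p, snd v) else v)"

definition isos :: "(int \<times> 'b::finite \<Rightarrow> int \<times> 'b \<Rightarrow> bool) \<Rightarrow> (int \<times> 'b \<Rightarrow> int \<times> 'b \<Rightarrow> bool) \<Rightarrow>
    (int \<times> 'b \<Rightarrow> int \<times> 'b) set" where
  "isos R R' = {f. f permutes V \<and> (\<forall>u\<in>V. \<forall>v\<in>V. R u v \<longleftrightarrow> R' (f u) (f v))}"

definition shift_invariant :: "(int \<times> 'b::finite \<Rightarrow> int \<times> 'b \<Rightarrow> bool) \<Rightarrow> bool" where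
  "shift_invariant R \<longleftrightarrow> (\<forall>i. shift i \<in> isos R R)"

text \<open>\<open>shift 1\<close> generates the cyclic group of translations, so for a permutation
  \<open>f\<close> of \<open>V\<close> the condition says that conjugation by \<open>f\<close> maps
  this group to itself.\<close>

definition normalizing :: "(int \<times> 'b::finite \<Rightarrow> int \<times> 'b) \<Rightarrow> bool" where
  "normalizing f \<longleftrightarrow> (\<exists>c. f \<circ> shift 1 = shift c \<circ> f)"

section \<open>Residues modulo \<open>p\<close>\<close>

lemma p_gt_1: "int p > 1"
  using prime_gt_1_nat[OF prime_p] by simp

lemma prime_int_p: "prime (int p)"
  using prime_p by simp

lemma mod_in_Zp [simp]: "x mod int p \<in> Zp"
  using p_gt_1 by (simp add: Zp_def)

lemma zero_in_Zp [simp]: "0 \<in> Zp" and one_in_Zp [simp]: "1 \<in> Zp"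
  using p_gt_1 by (simp_all add: Zp_def)

lemma Zp_mod: "x \<in> Zp \<Longrightarrow> x mod int p = x"
  by (simp add: Zp_def)

lemma finite_Zp [simp]: "finite Zp" and card_Zp [simp]: "card Zp = p"
  by (simp_all add: Zp_def)

lemma finite_V [simp]: "finite V"
  by (simp add: V_def)

lemma V_iff [simp]: "(x, b) \<in> V \<longleftrightarrow> x \<in> Zp"
  by (simp add: V_def)

lemma Zp_eq_iff: "x \<in> Zp \<Longrightarrow> y \<in> Zp \<Longrightarrow> x = y \<longleftrightarrow> int p dvd x - y"
  by (metis Zp_mod mod_eq_dvd_iff)

lemma inverse_mod:
  assumes "\<not> int p dvd c"
  obtains u where "[c * u = 1] (mod int p)"
proof -
  have "coprime c (int p)"
    using assms prime_imp_coprime[OF prime_int_p] by (simp add: coprime_commute)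
  then show ?thesis using cong_solve_coprime_int that by blast
qed

text \<open>Since \<open>c\<close> is invertible modulo \<open>p\<close>, steps of size
  \<open>c\<close> reach every residue. The natural number \<open>n\<close> counts the steps and
  allows induction along them.\<close>

lemma affine_solve:
  assumes "\<not> int p dvd c"
  obtains n where "(a + int n * c) mod int p = b mod int p"
proof -
  obtain u where u: "[c * u = 1] (mod int p)" using inverse_mod[OF assms] .
  define n where "n = nat (u * (b - a) mod int p)"
  have "[int n = u * (b - a)] (mod int p)"
    using p_gt_1 by (simp add: n_def)
  then have "[a + int n * c = a + (u * (b - a)) * c] (mod int p)"
    by (intro cong_add cong_mult) auto
  also have "a + (u * (b - a)) * c = a + (c * u) * (b - a)" by (simp add: algebra_simps)
  also have "[\<dots> = a + 1 * (b - a)] (mod int p)"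
    by (intro cong_add cong_mult u) auto
  finally show ?thesis using that by (simp add: cong_def)
qed

section \<open>The group of translations\<close>

lemma shift_add: "shift i \<circ> shift j = shift (i + j)"
  by (rule ext) (simp add: shift_def mod_simps algebra_simps)

lemma shift_add_app: "shift i (shift j v) = shift (i + j) v"
  using fun_cong[OF shift_add[of i j], of v] by simp

lemma shift_cong: "i mod int p = j mod int p \<Longrightarrow> shift i = shift j"
  by (rule ext) (auto simp: shift_def intro: mod_add_cong)

lemma shift_0 [simp]: "shift 0 = id"
  by (rule ext) (auto simp: shift_def Zp_mod)

lemma shift_eq_id: "shift i = (id :: int \<times> 'b::finite \<Rightarrow> _) \<longleftrightarrow> int p dvd i"
proof
  assume "shift i = (id :: int \<times> 'b::finite \<Rightarrow> _)"
  then have "shift i (0, undefined :: 'b) = (0, undefined)" by simp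
  then show "int p dvd i" by (simp add: shift_def dvd_eq_mod_eq_0)
next
  assume "int p dvd i"
  then have "i mod int p = 0 mod int p" by simp
  then show "shift i = (id :: int \<times> 'b::finite \<Rightarrow> _)" using shift_cong[of i 0] by simp
qed

lemma shift_permutes: "shift i permutes V"
proof (rule bij_imp_permutes)
  show "bij_betw (shift i) V V"
    by (rule bij_betw_byWitness[where f' = "shift (- i)"]) (auto simp: shift_def V_def mod_simps Zp_mod)
qed (auto simp: shift_def V_def)

section \<open>Composition and inversion of isomorphisms\<close>

lemma finite_isos [simp]: "finite (isos R R')"
  by (rule finite_subset[OF _ finite_permutations[OF finite_V]]) (auto simp: isos_def)

lemma isos_comp:
  assumes "f \<in> isos R R'" "g \<in> isos R' R''"
  shows "g \<circ> f \<in> isos R R''"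
proof -
  have "f v \<in> V" if "v \<in> V" for v using assms(1) that by (simp add: isos_def permutes_in_image)
  then show ?thesis using assms by (simp add: isos_def permutes_compose)
qed

lemma isos_inv:
  assumes "f \<in> isos R R'"
  shows "Hilbert_Choice.inv f \<in> isos R' R"
proof -
  have f: "f permutes V" using assms by (simp add: isos_def)
  have "Hilbert_Choice.inv f v \<in> V" if "v \<in> V" for v
    using permutes_inv[OF f] that by (simp add: permutes_in_image)
  then show ?thesis using assms f by (simp add: isos_def permutes_inv permutes_inverses)
qed

lemma id_in_isos [simp]: "id \<in> isos R R"
  by (simp add: isos_def permutes_id)

section \<open>Normalizing maps are affine\<close>

text \<open>Iterating the assumption gives the claim for natural \<open>i\<close>; every integer is
  congruent to a natural number, and a translation depends only on its residue.\<close>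

lemma normalizing_shift:
  assumes "f \<circ> shift 1 = shift c \<circ> f"
  shows "f (shift i v) = shift (c * i) (f v)"
proof -
  have nat: "f \<circ> shift (int n) = shift (c * int n) \<circ> f" for n
  proof (induction n)
    case (Suc n)
    have "f \<circ> shift (int (Suc n)) = f \<circ> shift (int n) \<circ> shift 1"
      by (simp add: comp_assoc shift_add add.commute)
    also have "\<dots> = shift (c * int n) \<circ> (f \<circ> shift 1)" by (simp only: Suc comp_assoc)
    also have "\<dots> = shift (c * int n) \<circ> shift c \<circ> f" by (simp only: assms comp_assoc)
    also have "\<dots> = shift (c * int (Suc n)) \<circ> f" by (simp add: shift_add algebra_simps)
    finally show ?case .
  qed simp
  have "shift i v = shift (int (nat (i mod int p))) v"
    using p_gt_1 by (intro fun_cong[OF shift_cong]) simp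
  then have "f (shift i v) = shift (c * int (nat (i mod int p))) (f v)"
    using fun_cong[OF nat, of "nat (i mod int p)" v] by (simp only: comp_apply)
  also have "\<dots> = shift (c * i) (f v)"
    using p_gt_1 by (intro fun_cong[OF shift_cong]) (simp add: mod_simps)
  finally show ?thesis .
qed

text \<open>The point \<open>(x, b)\<close> is \<open>shift x (0, b)\<close>. Hence one multiplier
  \<open>c\<close> governs all layers, and only the images of the base points \<open>(0, b)\<close>
  remain free.\<close>

lemma normalizing_affine:
  assumes f: "f permutes V" and c: "f \<circ> shift 1 = shift c \<circ> f" and x: "x \<in> Zp"
  shows "f (x, b) = ((fst (f (0, b)) + c * x) mod int p, snd (f (0, b)))"
proof -
  have "(x, b) = shift x (0, b)" using x by (simp add: shift_def Zp_mod)
  then have "f (x, b) = shift (c * x) (f (0, b))" using normalizing_shift[OF c] by simp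
  moreover have "f (0, b) \<in> V" using f by (simp add: permutes_in_image)
  then have "fst (f (0, b)) \<in> Zp" by (auto simp: V_def)
  ultimately show ?thesis by (simp add: shift_def)
qed

text \<open>Otherwise \<open>shift c\<close> is the identity, and cancelling \<open>f\<close> makes
  \<open>shift 1\<close> the identity too.\<close>

lemma normalizing_nonzero:
  assumes f: "f permutes V" and c: "f \<circ> shift 1 = shift c \<circ> f"
  shows "\<not> int p dvd c"
proof
  assume "int p dvd c"
  then have "f \<circ> shift 1 = f \<circ> id" using c by (simp add: shift_eq_id[THEN iffD2])
  then have "shift 1 = (id :: int \<times> 'a \<Rightarrow> _)"
    by (metis comp_assoc id_o permutes_inv_o(2)[OF f])
  then show False using p_gt_1 by (simp add: shift_eq_id)
qed

section \<open>Counting isomorphisms modulo \<open>p\<^sup>2\<close>\<close>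

text \<open>This makes the non-normalizing isomorphisms closed under translations on both sides. One
  direction suffices, since the translations can be undone.\<close>

lemma normalizing_comp_shift:
  assumes "f permutes V"
  shows "normalizing (shift i \<circ> f \<circ> shift j) \<longleftrightarrow> normalizing f"
proof -
  have *: "normalizing (shift i \<circ> f \<circ> shift j)" if nf: "normalizing f" for f :: "int \<times> 'a \<Rightarrow> int \<times> 'a" and i j
  proof -
    obtain c where c: "f \<circ> shift 1 = shift c \<circ> f" using nf unfolding normalizing_def by blast
    have "(shift i \<circ> f \<circ> shift j) \<circ> shift 1 = shift c \<circ> (shift i \<circ> f \<circ> shift j)"
      by (rule ext) (simp add: normalizing_shift[OF c] shift_add_app algebra_simps)
    then show ?thesis by (auto simp: normalizing_def)
  qed
  have "shift (- i) \<circ> (shift i \<circ> f \<circ> shift j) \<circ> shift (- j) = f"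
    by (rule ext) (simp add: shift_add_app)
  then show ?thesis using * by metis
qed

text \<open>Pairs of translations act freely on the non-normalizing isomorphisms, so every orbit has
  exactly \<open>p\<^sup>2\<close> elements: if two pairs send \<open>f\<close> to the same map,
  moving the translations to opposite sides yields a relation that either forces the pairs to agree
  or makes \<open>f\<close> normalizing.\<close>

lemma p_square_dvd_card_not_normalizing:
  assumes R: "shift_invariant R" "shift_invariant R'"
  shows "p\<^sup>2 dvd card {f \<in> isos R R'. \<not> normalizing f}"
proof -
  define M where "M = {f \<in> isos R R'. \<not> normalizing f}"
  define r where "r = {(f, g). f \<in> M \<and> g \<in> M \<and> (\<exists>i j. g = shift i \<circ> f \<circ> shift j)}"
  have M_perm: "f permutes V" if "f \<in> M" for f using that by (simp add: M_def isos_def)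
  have M_closed: "shift i \<circ> f \<circ> shift j \<in> M" if "f \<in> M" for f i j
    using that R by (auto simp: M_def normalizing_comp_shift[OF M_perm[OF that]] shift_invariant_def
        intro!: isos_comp)
  have "p\<^sup>2 dvd card M"
  proof (rule equiv_imp_dvd_card)
    show "finite M" by (simp add: M_def)
    show "equiv M r"
    proof (rule equivI)
      show "r \<subseteq> M \<times> M" by (auto simp: r_def)
      show "refl_on M r"
        by (auto simp: refl_on_def r_def intro!: exI[of _ 0])
      show "sym r"
      proof (rule symI)
        fix f g assume "(f, g) \<in> r"
        then obtain i j where *: "f \<in> M" "g \<in> M" "g = shift i \<circ> f \<circ> shift j" by (auto simp: r_def)
        have "f = shift (- i) \<circ> g \<circ> shift (- j)" unfolding *(3)
          by (rule ext) (simp add: shift_add_app)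
        then show "(g, f) \<in> r" using * unfolding r_def by blast
      qed
      show "trans r"
      proof (rule transI)
        fix f g h assume "(f, g) \<in> r" "(g, h) \<in> r"
        then obtain i j i' j' where *: "f \<in> M" "h \<in> M" "g = shift i \<circ> f \<circ> shift j"
          "h = shift i' \<circ> g \<circ> shift j'" by (auto simp: r_def)
        have "h = shift (i' + i) \<circ> f \<circ> shift (j + j')" unfolding *(3,4)
          by (rule ext) (simp add: shift_add_app)
        then show "(f, h) \<in> r" using * unfolding r_def by blast
      qed
    qed
    fix X assume "X \<in> M // r"
    then obtain f where f: "f \<in> M" "X = r `` {f}" by (auto elim: quotientE)
    note perm = M_perm[OF f(1)]
    let ?h = "\<lambda>(i, j). shift i \<circ> f \<circ> shift j"
    have "X = ?h ` (Zp \<times> Zp)"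
    proof
      show "X \<subseteq> ?h ` (Zp \<times> Zp)"
      proof
        fix g assume "g \<in> X"
        then obtain i j where g: "g = shift i \<circ> f \<circ> shift j" using f by (auto simp: r_def)
        have "shift i = (shift (i mod int p) :: int \<times> 'a \<Rightarrow> _)" "shift j = (shift (j mod int p) :: int \<times> 'a \<Rightarrow> _)"
          by (auto intro: shift_cong)
        then have "g = ?h (i mod int p, j mod int p)" using g by simp
        then show "g \<in> ?h ` (Zp \<times> Zp)" by (rule image_eqI) simp
      qed
      show "?h ` (Zp \<times> Zp) \<subseteq> X" using f M_closed by (auto simp: r_def)
    qed
    moreover have "inj_on ?h (Zp \<times> Zp)"
    proof (rule inj_onI, clarify)
      fix i j i' j' assume Z: "i \<in> Zp" "j \<in> Zp" "i' \<in> Zp" "j' \<in> Zp"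
        and eq: "shift i \<circ> f \<circ> shift j = shift i' \<circ> f \<circ> shift j'"
      have comm: "f (shift (j - j') v) = shift (i' - i) (f v)" for v
      proof -
        have "shift i (f (shift j (shift (- j') v))) = shift i' (f (shift j' (shift (- j') v)))"
          using fun_cong[OF eq, of "shift (- j') v"] by simp
        then have "shift (- i) (shift i (f (shift (j - j') v))) = shift (- i) (shift i' (f v))"
          by (simp add: shift_add_app)
        then show ?thesis by (simp add: shift_add_app)
      qed
      have j: "j = j'"
      proof (rule ccontr)
        assume "j \<noteq> j'"
        then have "\<not> int p dvd j - j'" using Z Zp_eq_iff by blast
        \<comment> \<open>Here \<open>n\<close> inverts \<open>j - j'\<close> modulo
          \<open>p\<close>: the \<open>n\<close>-th iterate of \<open>comm\<close> writes
          \<open>f \<circ> shift 1\<close> as a translation after \<open>f\<close>, which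
          contradicts the choice of \<open>f\<close> in \<open>M\<close>.\<close>
        then obtain n where n: "(0 + int n * (j - j')) mod int p = 1 mod int p" by (rule affine_solve)
        have pow: "f (shift (int n * (j - j')) v) = shift (int n * (i' - i)) (f v)" for n v
        proof (induction n arbitrary: v)
          case (Suc n)
          have "f (shift (int (Suc n) * (j - j')) v) = f (shift (j - j') (shift (int n * (j - j')) v))"
            by (simp add: shift_add_app algebra_simps)
          also have "\<dots> = shift (i' - i) (shift (int n * (i' - i)) (f v))" by (simp only: comm Suc)
          also have "\<dots> = shift (int (Suc n) * (i' - i)) (f v)"
            by (simp add: shift_add_app algebra_simps)
          finally show ?case .
        qed simp
        have "shift (int n * (j - j')) = (shift 1 :: int \<times> 'a \<Rightarrow> _)" using n by (intro shift_cong) simp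
        then have "f \<circ> shift 1 = shift (int n * (i' - i)) \<circ> f"
          using pow[of n] by (intro ext) simp
        then show False using f by (auto simp: M_def normalizing_def)
      qed
      have "shift (i' - i) = (id :: int \<times> 'a \<Rightarrow> _)"
      proof
        fix v :: "int \<times> 'a"
        have "shift (i' - i) (f (Hilbert_Choice.inv f v)) = f (Hilbert_Choice.inv f v)" using comm[of "Hilbert_Choice.inv f v"] j by simp
        then show "shift (i' - i) v = id v" by (simp add: permutes_inverses[OF perm])
      qed
      then have "i' = i" using Z by (simp add: shift_eq_id Zp_eq_iff)
      then show "i = i' \<and> j = j'" using j by simp
    qed
    ultimately show "p\<^sup>2 dvd card X" by (simp add: card_image power2_eq_square)
  qed
  then show ?thesis by (simp add: M_def)
qed

text \<open>Composition with \<open>f\<close> on the left or on the right is a bijection from an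
  automorphism group onto the set of isomorphisms.\<close>

lemma card_isos:
  assumes "f \<in> isos R R'"
  shows "card (isos R R') = card (isos R R)" "card (isos R R') = card (isos R' R')"
proof -
  have f: "f permutes V" using assms by (simp add: isos_def)
  have "bij_betw (\<lambda>g. f \<circ> g) (isos R R) (isos R R')"
    using assms isos_inv[OF assms]
    by (intro bij_betw_byWitness[where f' = "\<lambda>g. Hilbert_Choice.inv f \<circ> g"])
      (auto intro: isos_comp simp: permutes_inv_o[OF f] simp flip: comp_assoc)
  then show "card (isos R R') = card (isos R R)" by (simp add: bij_betw_same_card)
  have "bij_betw (\<lambda>g. g \<circ> f) (isos R' R') (isos R R')"
    using assms isos_inv[OF assms]
    by (intro bij_betw_byWitness[where f' = "\<lambda>g. g \<circ> Hilbert_Choice.inv f"])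
      (auto intro: isos_comp simp: permutes_inv_o[OF f] comp_assoc)
  then show "card (isos R R') = card (isos R' R')" by (simp add: bij_betw_same_card)
qed

text \<open>Modulo \<open>p\<^sup>2\<close>, all isomorphisms and the normalizing ones are equally
  many. As \<open>isos R R'\<close> has the same size as both automorphism groups, the
  non-divisibility passes to its normalizing part, which therefore cannot be empty.\<close>

lemma exists_normalizing:
  assumes f: "f \<in> isos R R'" and R: "shift_invariant R" "shift_invariant R'"
    and not_dvd: "\<not> p\<^sup>2 dvd card {f \<in> isos R R. normalizing f} \<or>
      \<not> p\<^sup>2 dvd card {f \<in> isos R' R'. normalizing f}"
  obtains g where "g \<in> isos R R'" "normalizing g"
proof -
  have split: "card (isos Q Q') = card {f \<in> isos Q Q'. normalizing f} + card {f \<in> isos Q Q'. \<not> normalizing f}"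
    for Q Q' :: "int \<times> 'a \<Rightarrow> int \<times> 'a \<Rightarrow> bool"
    by (subst card_Un_disjoint[symmetric]) (auto intro: arg_cong[where f = card])
  have *: "p\<^sup>2 dvd card {f \<in> isos Q Q'. normalizing f} \<longleftrightarrow> p\<^sup>2 dvd card (isos Q Q')"
    if "shift_invariant Q" "shift_invariant Q'" for Q Q' :: "int \<times> 'a \<Rightarrow> int \<times> 'a \<Rightarrow> bool"
    using p_square_dvd_card_not_normalizing[OF that] split[of Q Q'] by (simp add: dvd_add_left_iff)
  have "\<not> p\<^sup>2 dvd card {f \<in> isos R R'. normalizing f}"
    using not_dvd card_isos[OF f] R by (auto simp: *)
  then have "{f \<in> isos R R'. normalizing f} \<noteq> {}" by (metis card.empty dvd_0_right)
  then show ?thesis using that by blast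
qed

text \<open>The bound that refutes divisibility by \<open>p\<^sup>2\<close>: a nonempty set of
  normalizing automorphisms will be embedded into the pairs of distinct residues by evaluation at
  two points.\<close>

lemma card_off_diagonal: "card {(a, b). a \<in> Zp \<and> b \<in> Zp \<and> a \<noteq> b} < p\<^sup>2"
proof -
  have "{(a, b). a \<in> Zp \<and> b \<in> Zp \<and> a \<noteq> b} \<subset> Zp \<times> Zp"
    using zero_in_Zp by blast
  then have "card {(a, b). a \<in> Zp \<and> b \<in> Zp \<and> a \<noteq> b} < card (Zp \<times> Zp)"
    by (intro psubset_card_mono) auto
  then show ?thesis by (simp add: power2_eq_square)
qed

end


section \<open>Circulant digraphs of prime order\<close>

context prime_modulus
begin

lemma mod_add_mult_mod [simp]: "(a + c * (x mod int p)) mod int p = (a + c * x) mod int p"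
  by (metis mod_add_right_eq mod_mult_right_eq)

definition circ_arc :: "int set \<Rightarrow> int \<times> unit \<Rightarrow> int \<times> unit \<Rightarrow> bool" where
  "circ_arc S u v \<longleftrightarrow> (fst v - fst u) mod int p \<in> S"

lemma shift_invariant_circ_arc: "shift_invariant (circ_arc S)"
  by (auto simp: shift_invariant_def isos_def shift_permutes circ_arc_def shift_def mod_simps)

text \<open>The Cayley isomorphism property of the cyclic group of order \<open>p\<close>. A
  normalizing automorphism is affine, hence determined by the images of 0 and 1, which are distinct;
  so there are fewer than \<open>p\<^sup>2\<close> of them and at least one, the identity. A
  normalizing isomorphism then exists, and its multiplier is the required \<open>c\<close>.\<close>

lemma circulant_isomorphism_multiplier:
  assumes g: "bij_betw g Zp Zp"
    and iso: "\<And>x y. x \<in> Zp \<Longrightarrow> y \<in> Zp \<Longrightarrow> (y - x) mod int p \<in> S \<longleftrightarrow> (g y - g x) mod int p \<in> T"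
  obtains c where "\<not> int p dvd c" "\<And>x. x \<in> Zp \<Longrightarrow> x \<in> S \<longleftrightarrow> (c * x) mod int p \<in> T"
proof -
  \<comment> \<open>A copy of \<open>g\<close> on \<open>int \<times> unit\<close>, extended by the
    identity outside \<open>V\<close> to become a permutation.\<close>
  define f :: "int \<times> unit \<Rightarrow> int \<times> unit" where "f v = (if v \<in> V then (g (fst v), ()) else v)" for v
  have gZ: "g x \<in> Zp" if "x \<in> Zp" for x using g that by (auto simp: bij_betw_def)
  have "bij_betw f V V"
  proof (rule bij_betwI[where g = "\<lambda>v. (the_inv_into Zp g (fst v), ())"])
    show "f \<in> V \<rightarrow> V" by (auto simp: f_def gZ V_def)
    show "(\<lambda>v. (the_inv_into Zp g (fst v), ())) \<in> V \<rightarrow> V"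
      using the_inv_into_into[of g Zp _ Zp] g by (auto simp: V_def bij_betw_def)
  qed (use g in \<open>auto simp: f_def V_def bij_betw_def the_inv_into_f_f f_the_inv_into_f the_inv_into_into\<close>)
  then have "f permutes V" by (rule bij_imp_permutes) (simp add: f_def)
  then have f: "f \<in> isos (circ_arc S) (circ_arc T)"
    using iso by (auto simp: isos_def circ_arc_def f_def V_def)
  have "\<not> p\<^sup>2 dvd card {f \<in> isos (circ_arc S) (circ_arc S). normalizing f}"
  proof
    let ?N = "{f \<in> isos (circ_arc S) (circ_arc S). normalizing f}"
    let ?h = "\<lambda>f :: int \<times> unit \<Rightarrow> int \<times> unit. (fst (f (0, ())), fst (f (1, ())))"
    assume dvd: "p\<^sup>2 dvd card ?N"
    have "normalizing id" by (auto simp: normalizing_def)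
    then have "id \<in> ?N" by simp
    then have "card ?N > 0" by (intro card_gt_0_iff[THEN iffD2] conjI) (blast, simp)
    then have "p\<^sup>2 \<le> card ?N" using dvd by (simp add: dvd_imp_le)
    also have "card ?N \<le> card {(a, b). a \<in> Zp \<and> b \<in> Zp \<and> a \<noteq> b}"
    proof (rule card_inj_on_le[of ?h])
      show "inj_on ?h ?N"
      proof (rule inj_onI)
        fix f f' assume N: "f \<in> ?N" "f' \<in> ?N" and eq: "?h f = ?h f'"
        obtain c c' where c: "f \<circ> shift 1 = shift c \<circ> f" "f' \<circ> shift 1 = shift c' \<circ> f'"
          using N by (auto simp: normalizing_def)
        have perm: "f permutes V" "f' permutes V" using N by (auto simp: isos_def)
        note aff = normalizing_affine[OF perm(1) c(1)] normalizing_affine[OF perm(2) c(2)]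
        have "(fst (f (0, ())) + c) mod int p = (fst (f (0, ())) + c') mod int p"
          using eq aff(1)[of 1 "()"] aff(2)[of 1 "()"] by (metis (no_types) Pair_inject fst_conv mult.right_neutral one_in_Zp)
        then have cc: "c mod int p = c' mod int p" by (simp add: mod_eq_dvd_iff)
        show "f = f'"
        proof
          fix v :: "int \<times> unit"
          show "f v = f' v"
          proof (cases "v \<in> V")
            case True
            then obtain x where v: "v = (x, ())" "x \<in> Zp" by (auto simp: V_def)
            have "(c * x) mod int p = (c' * x) mod int p" using cc by (metis mod_mult_left_eq)
            then show ?thesis using aff(1)[OF v(2), of "()"] aff(2)[OF v(2), of "()"] eq v(1)
              by (auto intro: mod_add_cong)
          next
            case False
            then show ?thesis using perm by (simp add: permutes_not_in)
          qed
        qed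
      qed
      show "?h ` ?N \<subseteq> {(a, b). a \<in> Zp \<and> b \<in> Zp \<and> a \<noteq> b}"
      proof clarsimp
        fix f :: "int \<times> unit \<Rightarrow> int \<times> unit"
        assume "f \<in> isos (circ_arc S) (circ_arc S)"
        then have perm: "f permutes V" by (simp add: isos_def)
        have "f (0, ()) \<in> V" "f (1, ()) \<in> V" using perm by (auto simp: permutes_in_image)
        moreover have "f (0, ()) \<noteq> f (1, ())" using permutes_inj[OF perm] by (simp add: inj_eq)
        ultimately show "fst (f (0, ())) \<in> Zp \<and> fst (f (1, ())) \<in> Zp \<and> fst (f (0, ())) \<noteq> fst (f (1, ()))"
          by (auto simp: V_def prod_eq_iff)
      qed
      show "finite {(a, b). a \<in> Zp \<and> b \<in> Zp \<and> a \<noteq> b}"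
        by (rule finite_subset[of _ "Zp \<times> Zp"]) auto
    qed
    finally show False using card_off_diagonal by simp
  qed
  then obtain h where h: "h \<in> isos (circ_arc S) (circ_arc T)" "normalizing h"
    using exists_normalizing[OF f shift_invariant_circ_arc shift_invariant_circ_arc] by blast
  obtain c where c: "h \<circ> shift 1 = shift c \<circ> h" using h by (auto simp: normalizing_def)
  have perm: "h permutes V" using h by (simp add: isos_def)
  have "x \<in> S \<longleftrightarrow> (c * x) mod int p \<in> T" if x: "x \<in> Zp" for x
  proof -
    have "x \<in> S \<longleftrightarrow> circ_arc S (0, ()) (x, ())" using x by (simp add: circ_arc_def Zp_mod)
    also have "\<dots> \<longleftrightarrow> circ_arc T (h (0, ())) (h (x, ()))" using h x by (auto simp: isos_def)
    also have "\<dots> \<longleftrightarrow> (c * x) mod int p \<in> T"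
      using normalizing_affine[OF perm c x, of "()"] by (simp add: circ_arc_def mod_simps)
    finally show ?thesis .
  qed
  then show ?thesis using that normalizing_nonzero[OF perm c] by blast
qed

end


section \<open>The Cayley isomorphism property of the dihedral group\<close>

context prime_modulus
begin

text \<open>The pair \<open>(x, b)\<close> encodes the group element \<open>\<sigma>\<^sup>b \<tau>\<^sup>x\<close>; then \<^term>\<open>shift 1\<close> is right multiplication
  by \<open>\<tau>\<close>, \<open>swap\<close> is right multiplication by \<open>\<sigma>\<close>, and \<open>label u v\<close> encodes \<open>v u\<^sup>-\<^sup>1\<close>.\<close>

definition label :: "int \<times> bool \<Rightarrow> int \<times> bool \<Rightarrow> int \<times> bool" where
  "label u v = ((if snd u then fst u - fst v else fst v - fst u) mod int p, snd u \<noteq> snd v)"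

definition arc :: "(int \<times> bool) set \<Rightarrow> int \<times> bool \<Rightarrow> int \<times> bool \<Rightarrow> bool" where
  "arc S u v \<longleftrightarrow> label u v \<in> S"

text \<open>For \<open>c\<close> not divisible by \<open>p\<close>, this is the group automorphism
  given by \<tau> \<mapsto> \<tau>^c and \<sigma> \<mapsto> \<sigma> \<tau>^d.\<close>

definition aut :: "int \<Rightarrow> int \<Rightarrow> int \<times> bool \<Rightarrow> int \<times> bool" where
  "aut c d v = ((c * fst v + (if snd v then d else 0)) mod int p, snd v)"

section \<open>Right multiplications as automorphisms\<close>

text \<open>Right multiplication of \<open>u\<close> and \<open>v\<close> by the same element does
  not change the quotient of \<open>v\<close> by \<open>u\<close> that \<open>label\<close> encodes.
  The same reason applies to \<open>swap\<close> below.\<close>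

lemma shift_invariant_arc: "shift_invariant (arc S)"
  by (auto simp: shift_invariant_def isos_def shift_permutes arc_def label_def shift_def mod_simps)

definition swap :: "int \<times> bool \<Rightarrow> int \<times> bool" where
  "swap v = (if fst v \<in> Zp then ((- fst v) mod int p, \<not> snd v) else v)"

lemma swap_swap [simp]: "swap \<circ> swap = id"
  by (rule ext) (auto simp: swap_def mod_simps Zp_mod)

lemma swap_shift: "swap \<circ> shift i = shift (- i) \<circ> swap"
  by (rule ext) (auto simp: swap_def shift_def mod_simps)

lemma swap_in_isos: "swap \<in> isos (arc S) (arc S)"
proof -
  have "bij_betw swap V V"
    by (rule bij_betw_byWitness[where f' = swap]) (auto simp: swap_def V_def mod_simps Zp_mod)
  then have "swap permutes V"
    by (rule bij_imp_permutes) (auto simp: swap_def V_def)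
  then show ?thesis
    by (auto simp: isos_def arc_def label_def swap_def V_def mod_simps algebra_simps)
qed

text \<open>A nonzero \<open>e\<close> generates the additive group of residues, so a predicate with
  period \<open>e\<close> is constant.\<close>

lemma periodic_mod_const:
  assumes per: "\<And>z. P (z mod int p) \<longleftrightarrow> P ((z + e) mod int p)" and e: "\<not> int p dvd e"
  shows "P (a mod int p) \<longleftrightarrow> P (b mod int p)"
proof -
  obtain n where n: "(a + int n * e) mod int p = b mod int p" using affine_solve[OF e] .
  have "P (a mod int p) \<longleftrightarrow> P ((a + int n * e) mod int p)" for n
  proof (induction n)
    case (Suc n)
    then show ?case using per[of "a + int n * e"] by (simp add: algebra_simps)
  qed simp
  then show ?thesis using n by metis
qed

text \<open>A normalizing permutation maps each translation orbit onto a translation orbit. If both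
  base points went to the same layer, some translate of \<open>(0, False)\<close> would have the
  same image as \<open>(0, True)\<close>, against injectivity.\<close>

lemma normalizing_snd:
  assumes f: "f permutes V" and c: "f \<circ> shift 1 = shift c \<circ> f"
  shows "snd (f (0, True)) \<longleftrightarrow> \<not> snd (f (0, False))"
proof (rule ccontr)
  assume "\<not> ?thesis"
  then have same: "snd (f (0, True)) = snd (f (0, False))" by auto
  note aff = normalizing_affine[OF f c]
  obtain n where n: "(fst (f (0, False)) + int n * c) mod int p = fst (f (0, True)) mod int p"
    using affine_solve[OF normalizing_nonzero[OF f c]] .
  have "f (int n mod int p, False) = ((fst (f (0, False)) + int n * c) mod int p, snd (f (0, True)))"
    using aff[of "int n mod int p" False] same by (simp add: mod_simps mult.commute)
  also have "\<dots> = f (0, True)" using n aff[of 0 True] by simp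
  finally show False using permutes_inj[OF f] by (simp add: inj_eq)
qed

text \<open>Composition with \<open>swap\<close> contributes a factor 2, which is coprime to
  \<open>p\<^sup>2\<close>, so it suffices to count the automorphisms that preserve the layers. Two
  of these that agree at \<open>(0, False)\<close> and \<open>(1, False)\<close> have the same
  multiplier; if they differed on the reflections by an offset, the reflections in \<open>S\<close>
  would be periodic and hence all or none. Evaluation at the two points is therefore injective, with
  distinct values.\<close>

lemma card_normalizing_automorphisms:
  assumes "odd p" and mixed: "a \<in> Zp" "b \<in> Zp" "(a, True) \<in> S" "(b, True) \<notin> S"
  shows "\<not> p\<^sup>2 dvd card {f \<in> isos (arc S) (arc S). normalizing f}"
proof
  let ?N = "{f \<in> isos (arc S) (arc S). normalizing f}"
  let ?M = "{f \<in> ?N. \<not> snd (f (0, False))}"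
  let ?h = "\<lambda>f :: int \<times> bool \<Rightarrow> int \<times> bool. (fst (f (0, False)), fst (f (1, False)))"
  assume dvd: "p\<^sup>2 dvd card ?N"
  have swapN: "f \<circ> swap \<in> ?N \<and> (snd ((f \<circ> swap) (0, False)) \<longleftrightarrow> \<not> snd (f (0, False)))" if "f \<in> ?N" for f
  proof -
    have perm: "f permutes V" using that by (simp add: isos_def)
    obtain c where c: "f \<circ> shift 1 = shift c \<circ> f" using \<open>f \<in> ?N\<close> by (auto simp: normalizing_def)
    have "(f \<circ> swap) \<circ> shift 1 = shift (- c) \<circ> (f \<circ> swap)"
      using normalizing_shift[OF c, of "- 1"] fun_cong[OF swap_shift, of 1] by (intro ext) simp
    then have "normalizing (f \<circ> swap)" unfolding normalizing_def by blast
    moreover have "f \<circ> swap \<in> isos (arc S) (arc S)" using that isos_comp[OF swap_in_isos] by blast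
    moreover have "(f \<circ> swap) (0, False) = f (0, True)" by (simp add: swap_def)
    ultimately show ?thesis using normalizing_snd[OF perm c] by simp
  qed
  have union: "?N = ?M \<union> (\<lambda>f. f \<circ> swap) ` ?M"
  proof
    show "?N \<subseteq> ?M \<union> (\<lambda>f. f \<circ> swap) ` ?M"
    proof
      fix f assume f: "f \<in> ?N"
      have "f = (f \<circ> swap) \<circ> swap" by (simp add: comp_assoc)
      then show "f \<in> ?M \<union> (\<lambda>f. f \<circ> swap) ` ?M" using f swapN[OF f] by blast
    qed
    show "?M \<union> (\<lambda>f. f \<circ> swap) ` ?M \<subseteq> ?N" using swapN by blast
  qed
  have disj: "?M \<inter> (\<lambda>f. f \<circ> swap) ` ?M = {}" using swapN by blast
  have inj: "inj_on (\<lambda>f. f \<circ> swap) ?M"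
    by (rule inj_onI) (metis comp_assoc comp_id swap_swap)
  have "card ?N = card ?M + card ?M"
    by (subst union, subst card_Un_disjoint[OF _ _ disj]) (simp, simp, simp only: card_image[OF inj])
  then have "card ?N = 2 * card ?M" by simp
  then have "p\<^sup>2 dvd 2 * card ?M" using dvd by simp
  moreover have "coprime (p\<^sup>2) 2" using \<open>odd p\<close> by simp
  ultimately have dvd0: "p\<^sup>2 dvd card ?M" by (simp add: coprime_dvd_mult_right_iff)
  have "normalizing id" by (auto simp: normalizing_def)
  then have "id \<in> ?M" by simp
  then have "card ?M > 0" by (intro card_gt_0_iff[THEN iffD2] conjI) (blast, simp)
  then have "p\<^sup>2 \<le> card ?M" using dvd0 by (simp add: dvd_imp_le)
  also have "card ?M \<le> card {(a, b). a \<in> Zp \<and> b \<in> Zp \<and> a \<noteq> b}"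
  proof (rule card_inj_on_le[of ?h])
    show "inj_on ?h ?M"
    proof (rule inj_onI)
      fix f f' assume N: "f \<in> ?M" "f' \<in> ?M" and eq: "?h f = ?h f'"
      obtain c c' where c: "f \<circ> shift 1 = shift c \<circ> f" "f' \<circ> shift 1 = shift c' \<circ> f'"
        using N by (auto simp: normalizing_def)
      have perm: "f permutes V" "f' permutes V" using N by (auto simp: isos_def)
      note aff = normalizing_affine[OF perm(1) c(1)] normalizing_affine[OF perm(2) c(2)]
      have snds: "\<not> snd (f (0, False))" "\<not> snd (f' (0, False))" "snd (f (0, True))" "snd (f' (0, True))"
        using N normalizing_snd[OF perm(1) c(1)] normalizing_snd[OF perm(2) c(2)] by auto
      have "(fst (f (0, False)) + c) mod int p = (fst (f (0, False)) + c') mod int p"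
        using eq aff(1)[of 1 False] aff(2)[of 1 False]
          by (metis (no_types) Pair_inject fst_conv mult.right_neutral one_in_Zp)
      then have cc: "c mod int p = c' mod int p" by (simp add: mod_eq_dvd_iff)
      then have cx: "(c * x) mod int p = (c' * x) mod int p" for x by (metis mod_mult_left_eq)
      \<comment> \<open>The offset between \<open>f\<close> and \<open>f'\<close> on the
        reflections. The aim is to show that a nonzero offset is a period of the set of reflections
        in \<open>S\<close>.\<close>
      define e where "e = fst (f' (0, True)) - fst (f (0, True))"
      have "int p dvd e"
      proof (rule ccontr)
        assume e: "\<not> int p dvd e"
        have "(z mod int p, True) \<in> S \<longleftrightarrow> ((z + e) mod int p, True) \<in> S" for z
        proof -
          define o0 where "o0 = fst (f (0, False))"
          define o1 where "o1 = fst (f (0, True))"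
          \<comment> \<open>The reflection \<open>x\<close> is chosen such that \<open>f\<close>
            sends the arc label \<open>(x, True)\<close> seen from \<open>(0, False)\<close> to the
            label of \<open>z\<close>; then \<open>f'\<close> sends it to the label of
            \<open>z + e\<close>. Both memberships are equivalent to that of
            \<open>(x, True)\<close>.\<close>
          obtain n where n: "(o1 - o0 + int n * c) mod int p = z mod int p"
            using affine_solve[OF normalizing_nonzero[OF perm(1) c(1)]] .
          define x where "x = int n mod int p"
          have x: "x \<in> Zp" by (simp add: x_def)
          have zx: "(o1 - o0 + c * x) mod int p = z mod int p"
            using n by (simp add: x_def mod_simps mult.commute)
          have *: "(x, True) \<in> S \<longleftrightarrow> label (g (0, False)) (g (x, True)) \<in> S" if "g \<in> ?M" for g
          proof -
            have "(x, True) \<in> S \<longleftrightarrow> arc S (0, False) (x, True)"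
              using x by (simp add: arc_def label_def Zp_mod)
            also have "\<dots> \<longleftrightarrow> arc S (g (0, False)) (g (x, True))" using that x by (simp add: isos_def)
            finally show ?thesis by (simp add: arc_def)
          qed
          have "label (f (0, False)) (f (x, True)) = ((o1 - o0 + c * x) mod int p, True)"
            using aff(1)[OF x, of True] snds by (simp add: label_def o0_def o1_def mod_simps algebra_simps)
          then have 1: "label (f (0, False)) (f (x, True)) = (z mod int p, True)" by (simp add: zx)
          have "label (f' (0, False)) (f' (x, True)) = ((o1 + e - o0 + c' * x) mod int p, True)"
            using aff(2)[OF x, of True] snds eq
            by (simp add: label_def o0_def o1_def e_def mod_simps algebra_simps)
          moreover have "(o1 + e - o0 + c' * x) mod int p = (z + e) mod int p"
          proof -
            have "[o1 + e - o0 + c' * x = o1 + e - o0 + c * x] (mod int p)"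
              using cx[of x] by (intro cong_add) (auto simp: cong_def)
            also have "o1 + e - o0 + c * x = (o1 - o0 + c * x) + e" by simp
            also have "[\<dots> = z + e] (mod int p)" using zx by (intro cong_add) (auto simp: cong_def)
            finally show ?thesis by (simp add: cong_def)
          qed
          ultimately have 2: "label (f' (0, False)) (f' (x, True)) = ((z + e) mod int p, True)" by simp
          show ?thesis using *[OF N(1)] *[OF N(2)] by (simp only: 1 2)
        qed
        from periodic_mod_const[of "\<lambda>x. (x, True) \<in> S", OF this e, of a b] mixed
        show False by (simp add: Zp_mod)
      qed
      moreover have "f (0, True) \<in> V" "f' (0, True) \<in> V"
        using perm by (simp_all add: permutes_in_image)
      ultimately have "fst (f' (0, True)) = fst (f (0, True))"
        by (subst Zp_eq_iff) (auto simp: V_def e_def)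
      then have same: "f (0, b) = f' (0, b)" for b
        using snds eq by (cases b) (auto simp: prod_eq_iff)
      show "f = f'"
      proof
        fix v
        show "f v = f' v"
        proof (cases "v \<in> V")
          case True
          then obtain x b where v: "v = (x, b)" "x \<in> Zp" by (auto simp: V_def)
          show ?thesis using aff(1)[OF v(2), of b] aff(2)[OF v(2), of b] same[of b] v(1) cx[of x]
            by (auto intro: mod_add_cong)
        next
          case False
          then show ?thesis using perm by (simp add: permutes_not_in)
        qed
      qed
    qed
    show "?h ` ?M \<subseteq> {(a, b). a \<in> Zp \<and> b \<in> Zp \<and> a \<noteq> b}"
    proof (rule image_subsetI)
      fix f assume f: "f \<in> ?M"
      then have perm: "f permutes V" by (simp add: isos_def)
      obtain c where c: "f \<circ> shift 1 = shift c \<circ> f" using f by (auto simp: normalizing_def)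
      have "f (0, False) \<in> V" "f (1, False) \<in> V" using perm by (auto simp: permutes_in_image)
      moreover have "f (0, False) \<noteq> f (1, False)" using permutes_inj[OF perm] by (simp add: inj_eq)
      moreover have "snd (f (1, False)) = snd (f (0, False))"
        using normalizing_affine[OF perm c, of 1 False] by simp
      ultimately show "?h f \<in> {(a, b). a \<in> Zp \<and> b \<in> Zp \<and> a \<noteq> b}"
        by (auto simp: V_def prod_eq_iff)
    qed
    show "finite {(a, b). a \<in> Zp \<and> b \<in> Zp \<and> a \<noteq> b}"
      by (rule finite_subset[of _ "Zp \<times> Zp"]) auto
  qed
  finally show False using card_off_diagonal by simp
qed

section \<open>From isomorphisms to group automorphisms\<close>

text \<open>Although \<open>f\<close> need not fix the identity, multiplying its values on the right
  by the inverse of \<open>f (0, False)\<close> gives a group automorphism, and right multiplication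
  does not affect arcs.\<close>

lemma normalizing_isomorphism_aut:
  assumes f: "f \<in> isos (arc S) (arc T)" "normalizing f"
  obtains c d where "\<not> int p dvd c" "\<And>v. v \<in> V \<Longrightarrow> v \<in> S \<longleftrightarrow> aut c d v \<in> T"
proof -
  obtain c where c: "f \<circ> shift 1 = shift c \<circ> f" using f by (auto simp: normalizing_def)
  have perm: "f permutes V" using f by (simp add: isos_def)
  note aff = normalizing_affine[OF perm c]
  define o0 where "o0 = fst (f (0, False))"
  define o1 where "o1 = fst (f (0, True))"
  \<comment> \<open>If \<open>f\<close> sends the identity to a reflection, the quotient by that
    reflection reverses the sign of the first component.\<close>
  define s where "s = (if snd (f (0, False)) then - 1 else 1 :: int)"
  have snds: "snd (f (0, True)) \<longleftrightarrow> \<not> snd (f (0, False))" by (rule normalizing_snd[OF perm c])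
  have "v \<in> S \<longleftrightarrow> aut (s * c) (s * (o1 - o0)) v \<in> T" if v: "v \<in> V" for v
  proof -
    obtain x b where xb: "v = (x, b)" "x \<in> Zp" using v by (auto simp: V_def)
    have "v \<in> S \<longleftrightarrow> arc S (0, False) v" using xb by (simp add: arc_def label_def Zp_mod)
    also have "\<dots> \<longleftrightarrow> arc T (f (0, False)) (f v)" using f xb by (simp add: isos_def)
    also have "label (f (0, False)) (f v) = aut (s * c) (s * (o1 - o0)) v"
      using aff[OF xb(2), of b] snds xb
      by (cases b) (auto simp: label_def aut_def s_def o0_def o1_def mod_simps algebra_simps)
    then have "arc T (f (0, False)) (f v) \<longleftrightarrow> aut (s * c) (s * (o1 - o0)) v \<in> T" by (simp add: arc_def)
    finally show ?thesis .
  qed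
  moreover have "\<not> int p dvd s * c" using normalizing_nonzero[OF perm c] by (simp add: s_def)
  ultimately show ?thesis using that by blast
qed

text \<open>Arcs labelled by rotations stay within a layer, and a nonzero rotation in
  \<open>S\<close> connects the whole layer of rotations. So \<open>f\<close> maps this layer into a
  single layer, where it induces an isomorphism of circulant digraphs; the multiplier found there
  works with \<open>d = 0\<close>.\<close>

lemma rotation_isomorphism_aut:
  assumes S: "S \<subseteq> Zp \<times> {False}" and T: "T \<subseteq> Zp \<times> {False}"
    and S0: "(0, False) \<notin> S"  and f: "f \<in> isos (arc S) (arc T)"
    and card: "card S = card T"
  obtains c d where "\<not> int p dvd c" "\<And>v. v \<in> V \<Longrightarrow> v \<in> S \<longleftrightarrow> aut c d v \<in> T"
proof (cases "S = {}")
  case True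
  \<comment> \<open>Without arcs there is no connectedness to use, but equal cardinalities make
    \<open>T\<close> empty as well, and the identity automorphism serves.\<close>
  have "finite T" using T by (rule finite_subset) simp
  then have "T = {}" using True card by simp
  then show ?thesis using True p_gt_1 that[of 1 0] by auto
next
  case False
  then obtain s where s: "(s, False) \<in> S" using S by auto
  then have "s \<in> Zp" "s \<noteq> 0" using S S0 by auto
  then have ndvd: "\<not> int p dvd s" using Zp_eq_iff[of s 0] by simp
  have perm: "f permutes V" using f by (simp add: isos_def)
  define t where "t = snd (f (0, False))"
  have "snd (f (int n * s mod int p, False)) = t" for n
  proof (induction n)
    case (Suc n)
    let ?u = "(int n * s mod int p, False)" and ?v = "(int (Suc n) * s mod int p, False)"
    have "label ?u ?v = (s, False)"
      using \<open>s \<in> Zp\<close> by (simp add: label_def mod_simps Zp_mod algebra_simps)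
    then have "arc S ?u ?v" using s by (simp add: arc_def)
    then have "arc T (f ?u) (f ?v)" using f by (simp add: isos_def)
    then have "snd (f ?u) = snd (f ?v)" using T by (auto simp: arc_def label_def)
    then show ?case using Suc by simp
  qed (simp add: t_def)
  then have snd_f: "snd (f (x, False)) = t" if "x \<in> Zp" for x
  proof -
    obtain n where "(0 + int n * s) mod int p = x mod int p" using affine_solve[OF ndvd] .
    then show ?thesis using that \<open>\<And>n. snd (f (int n * s mod int p, False)) = t\<close>[of n] by (simp add: Zp_mod)
  qed
  \<comment> \<open>\<open>label\<close> subtracts in the opposite order in the layer of
    reflections; the sign compensates for this if \<open>f\<close> lands there.\<close>
  define e where "e = (if t then - 1 else 1 :: int)"
  have e2: "e * e = 1" by (simp add: e_def)
  define g where "g x = e * fst (f (x, False)) mod int p" for x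
  have fV: "fst (f (x, False)) \<in> Zp" if "x \<in> Zp" for x
  proof -
    have "f (x, False) \<in> V" using perm that by (simp add: permutes_in_image)
    then show ?thesis by (auto simp: V_def)
  qed
  have "inj_on g Zp"
  proof (rule inj_onI)
    fix x y assume xy: "x \<in> Zp" "y \<in> Zp" "g x = g y"
    have "(e * g x) mod int p = fst (f (x, False))" "(e * g y) mod int p = fst (f (y, False))"
      using fV xy(1,2) e2 by (simp_all add: g_def mod_simps Zp_mod flip: mult.assoc)
    then have "f (x, False) = f (y, False)" using xy snd_f by (simp add: prod_eq_iff)
    then show "x = y" using permutes_inj[OF perm] by (simp add: inj_eq)
  qed
  moreover have "g ` Zp \<subseteq> Zp" by (auto simp: g_def)
  ultimately have bij: "bij_betw g Zp Zp"
    by (simp add: bij_betw_def endo_inj_surj)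
  have iso: "(y - x) mod int p \<in> {x. (x, False) \<in> S} \<longleftrightarrow> (g y - g x) mod int p \<in> {x. (x, False) \<in> T}"
    if "x \<in> Zp" "y \<in> Zp" for x y
  proof -
    have "((y - x) mod int p, False) \<in> S \<longleftrightarrow> arc S (x, False) (y, False)"
      by (simp add: arc_def label_def)
    also have "\<dots> \<longleftrightarrow> arc T (f (x, False)) (f (y, False))" using f that by (simp add: isos_def)
    also have "\<dots> \<longleftrightarrow> ((g y - g x) mod int p, False) \<in> T"
      using snd_f that by (auto simp: arc_def label_def g_def mod_simps e_def algebra_simps)
    finally show ?thesis by simp
  qed
  obtain c where c: "\<not> int p dvd c"
    "\<And>x. x \<in> Zp \<Longrightarrow> x \<in> {x. (x, False) \<in> S} \<longleftrightarrow> (c * x) mod int p \<in> {x. (x, False) \<in> T}"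
    using circulant_isomorphism_multiplier[OF bij iso] by blast
  have "v \<in> S \<longleftrightarrow> aut c 0 v \<in> T" if "v \<in> V" for v
  proof -
    obtain x b where v: "v = (x, b)" "x \<in> Zp" using \<open>v \<in> V\<close> by (auto simp: V_def)
    show ?thesis
    proof (cases b)
      case True
      then show ?thesis using v S T by (auto simp: aut_def)
    next
      case False
      then show ?thesis using v c(2)[OF v(2)] by (simp add: aut_def)
    qed
  qed
  then show ?thesis using that c(1) by blast
qed

lemma label_eq_0_iff:
  assumes "u \<in> V" "v \<in> V"
  shows "label u v = (0, False) \<longleftrightarrow> u = v"
proof -
  obtain x a y b where uv: "u = (x, a)" "v = (y, b)" "x \<in> Zp" "y \<in> Zp" using assms by (auto simp: V_def)
  have "(x - y) mod int p = 0 \<longleftrightarrow> x = y" "(y - x) mod int p = 0 \<longleftrightarrow> x = y"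
    using Zp_eq_iff[OF uv(3,4)] Zp_eq_iff[OF uv(4,3)] by (auto simp flip: dvd_eq_mod_eq_0)
  then show ?thesis by (auto simp: label_def uv(1,2))
qed

lemma aut_in_V [simp]: "aut c d v \<in> V"
  by (simp add: aut_def)

lemma aut_eq_0_iff:
  assumes "\<not> int p dvd c" "v \<in> V"
  shows "aut c d v = (0, False) \<longleftrightarrow> v = (0, False)"
proof -
  obtain x b where v: "v = (x, b)" "x \<in> Zp" using assms(2) by (auto simp: V_def)
  have "c * x mod int p = 0 \<longleftrightarrow> x = 0"
    using assms(1) Zp_eq_iff[OF v(2) zero_in_Zp]
    by (auto simp: prime_dvd_mult_iff[OF prime_int_p] simp flip: dvd_eq_mod_eq_0)
  then show ?thesis using v by (auto simp: aut_def)
qed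

text \<open>If \<open>S\<close> or \<open>T\<close> contains some but not all reflections, the count
  above yields a normalizing isomorphism. Otherwise each contains all reflections or none; equal
  cardinalities put both in the same case, and passing to complements reduces the first case to sets
  of rotations.\<close>

theorem isomorphism_imp_aut:
  assumes "odd p" and S: "S \<subseteq> V - {(0, False)}" and T: "T \<subseteq> V - {(0, False)}"
    and card: "card S = card T" and f: "f \<in> isos (arc S) (arc T)"
  obtains c d where "\<not> int p dvd c" "\<And>v. v \<in> V \<Longrightarrow> v \<in> S \<longleftrightarrow> aut c d v \<in> T"
proof -
  let ?mixed = "\<lambda>S. \<exists>a\<in>Zp. \<exists>b\<in>Zp. (a, True) \<in> S \<and> (b, True) \<notin> S"
  show ?thesis
  proof (cases "?mixed S \<or> ?mixed T")
    case True
    then have "\<not> p\<^sup>2 dvd card {f \<in> isos (arc S) (arc S). normalizing f} \<or>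
      \<not> p\<^sup>2 dvd card {f \<in> isos (arc T) (arc T). normalizing f}"
      using card_normalizing_automorphisms[OF \<open>odd p\<close>] by meson
    then obtain g where "g \<in> isos (arc S) (arc T)" "normalizing g"
      using exists_normalizing[OF f shift_invariant_arc shift_invariant_arc] by blast
    then show ?thesis using normalizing_isomorphism_aut that by blast
  next
    case False
    \<comment> \<open>There are only \<open>p - 1\<close> non-identity rotations, so in the
      non-mixed case the cardinality alone tells whether the reflections belong to the set.\<close>
    have full: "Zp \<times> {True} \<subseteq> X \<longleftrightarrow> card X \<ge> p"
      if X: "X \<subseteq> V - {(0, False)}" and nm: "\<not> ?mixed X" for X
    proof
      have fin: "finite X" using X by (rule finite_subset) simp
      { assume "Zp \<times> {True} \<subseteq> X"
        then have "card (Zp \<times> {True}) \<le> card X" by (rule card_mono[OF fin])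
        then show "card X \<ge> p" by simp }
      { assume ge: "card X \<ge> p"
        show "Zp \<times> {True} \<subseteq> X"
        proof (rule ccontr)
          assume "\<not> Zp \<times> {True} \<subseteq> X"
          then have "X \<subseteq> (Zp - {0}) \<times> {False}" using nm X by (auto simp: V_def)
          then have "card X \<le> card ((Zp - {0}) \<times> {False})" by (intro card_mono) auto
          also have "\<dots> = p - 1" by simp
          finally show False using ge p_gt_1 by simp
        qed }
    qed
    show ?thesis
    proof (cases "card S \<ge> p")
      case less: False
      have "S \<subseteq> Zp \<times> {False}" "T \<subseteq> Zp \<times> {False}"
        using full[OF S] full[OF T] less card False S T by (auto simp: V_def)
      then show ?thesis using rotation_isomorphism_aut[OF _ _ _ f card] S that by blast
    next
      case True
      \<comment> \<open>The complement is taken among the non-identity elements, so that no loops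
        arise. Being injective, \<open>f\<close> is also an isomorphism of the complementary
        digraphs.\<close>
      define S' where "S' = V - {(0, False)} - S"
      define T' where "T' = V - {(0, False)} - T"
      have "Zp \<times> {True} \<subseteq> S" "Zp \<times> {True} \<subseteq> T" using full[OF S] full[OF T] True False card by auto
      then have sub: "S' \<subseteq> Zp \<times> {False}" "T' \<subseteq> Zp \<times> {False}"
        by (auto simp: S'_def T'_def V_def)
      have "finite S" "finite T" using S T by (auto intro: finite_subset[OF _ finite_V])
      then have card': "card S' = card T'"
        unfolding S'_def T'_def using S T card by (simp add: card_Diff_subset)
      have compl: "arc (V - {(0, False)} - X) u v \<longleftrightarrow> u \<noteq> v \<and> \<not> arc X u v" if "u \<in> V" "v \<in> V" for u v X
      proof -
        have "label u v \<in> V" by (simp add: label_def)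
        then show ?thesis using label_eq_0_iff[OF that] by (auto simp: arc_def)
      qed
      have perm: "f permutes V" using f by (simp add: isos_def)
      have f': "f \<in> isos (arc S') (arc T')"
        using f permutes_inj[OF perm]
        by (auto simp: isos_def S'_def T'_def compl permutes_in_image inj_eq)
      obtain c d where cd: "\<not> int p dvd c" "\<And>v. v \<in> V \<Longrightarrow> v \<in> S' \<longleftrightarrow> aut c d v \<in> T'"
        using rotation_isomorphism_aut[OF sub _ f' card'] by (auto simp: S'_def)
      have "v \<in> S \<longleftrightarrow> aut c d v \<in> T" if v: "v \<in> V" for v
        using cd(2)[OF v] v aut_eq_0_iff[OF cd(1) v, of d] S T
        by (auto simp: S'_def T'_def)
      then show ?thesis using that cd(1) by blast
    qed
  qed
qed

end


section \<open>Counting invariant subsets\<close>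

text \<open>\<open>BijGroup E\<close> consists of extensional maps, hence the restriction to
  \<open>E\<close>. Acting with the inverse element provides bijectivity.\<close>

lemma group_action_restrict:
  fixes G (structure)
  assumes "group G"
    and closed: "\<And>g x. g \<in> carrier G \<Longrightarrow> x \<in> E \<Longrightarrow> \<psi> g x \<in> E"
    and one: "\<And>x. x \<in> E \<Longrightarrow> \<psi> \<one> x = x"
    and mult: "\<And>g h x. g \<in> carrier G \<Longrightarrow> h \<in> carrier G \<Longrightarrow> x \<in> E \<Longrightarrow> \<psi> (g \<otimes> h) x = \<psi> g (\<psi> h x)"
  shows "group_action G E (\<lambda>g. restrict (\<psi> g) E)"
proof -
  interpret group G by fact
  have Bij: "restrict (\<psi> g) E \<in> Bij E" if g: "g \<in> carrier G" for g
  proof -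
    have "\<psi> (inv g) (\<psi> g x) = x" "\<psi> g (\<psi> (inv g) x) = x" if "x \<in> E" for x
      using mult[of "inv g" g x] mult[of g "inv g" x] g that one by simp_all
    then have "bij_betw (restrict (\<psi> g) E) E E"
      using g closed by (intro bij_betw_byWitness[where f' = "\<psi> (inv g)"]) auto
    then show ?thesis by (simp add: Bij_def)
  qed
  have "restrict (\<psi> (g \<otimes> h)) E = compose E (restrict (\<psi> g) E) (restrict (\<psi> h) E)"
    if "g \<in> carrier G" "h \<in> carrier G" for g h
    by (rule ext) (use that closed mult in \<open>auto simp: compose_def\<close>)
  then have "(\<lambda>g. restrict (\<psi> g) E) \<in> hom G (BijGroup E)"
    using Bij by (auto simp: hom_def BijGroup_def)
  then show ?thesis
    unfolding group_action_def group_hom_def group_hom_axioms_def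
    using group_BijGroup \<open>group G\<close> by blast
qed

text \<open>These are the fixed points of \<open>g\<close> on the \<open>k\<close>-subsets of
  \<open>W\<close>, to be counted for Burnside's lemma.\<close>

definition stable_subsets :: "('a \<Rightarrow> 'a) \<Rightarrow> 'a set \<Rightarrow> nat \<Rightarrow> 'a set set" where
  "stable_subsets g W k = {S. S \<subseteq> W \<and> card S = k \<and> g ` S = S}"

lemma finite_stable_subsets: "finite W \<Longrightarrow> finite (stable_subsets g W k)"
  by (rule finite_subset[of _ "Pow W"]) (auto simp: stable_subsets_def)

text \<open>The assumption \<open>period\<close> says that all cycles of \<open>g\<close> on
  \<open>W\<close> have length \<open>m\<close>. A stable set is a union of cycles, so a stable set
  of size \<open>k\<close> amounts to a choice of \<open>k div m\<close> among the
  \<open>card W div m\<close> cycles.\<close>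

lemma card_stable_subsets_uniform:
  assumes fin: "finite W" and g: "bij_betw g W W" and m: "m > 0"
    and period: "\<And>w i. w \<in> W \<Longrightarrow> (g ^^ i) w = w \<longleftrightarrow> m dvd i"
  shows "card (stable_subsets g W k) = (if m dvd k then (card W div m) choose (k div m) else 0)"
proof -
  define r where "r = {(u, v). u \<in> W \<and> v \<in> W \<and> (\<exists>i. v = (g ^^ i) u)}"
  have pow_bij: "bij_betw (g ^^ i) W W" for i
    by (rule bij_betw_funpow[OF g])
  then have pow_in: "(g ^^ i) w \<in> W" if "w \<in> W" for i w
    using that bij_betwE by blast
  \<comment> \<open>The exponent \<open>i * m - i\<close> plays the role of \<open>- i\<close>:
    added to \<open>i\<close> it gives a multiple of the period, and \<open>m > 0\<close> keeps the
    subtraction from being truncated.\<close>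
  have pow_back: "(g ^^ (i * m - i)) ((g ^^ i) u) = u" if "u \<in> W" for i u
  proof -
    have "(g ^^ (i * m - i)) ((g ^^ i) u) = (g ^^ (i * m - i + i)) u" by (simp add: funpow_add)
    also have "i * m - i + i = i * m" using m by simp
    finally show ?thesis using period[OF that] by simp
  qed
  have eq: "equiv W r"
  proof (rule equivI)
    show "r \<subseteq> W \<times> W" by (auto simp: r_def)
    show "refl_on W r" by (auto simp: refl_on_def r_def intro!: exI[of _ 0])
    show "sym r"
    proof (rule symI)
      fix u v assume "(u, v) \<in> r"
      then obtain i where uv: "u \<in> W" "v \<in> W" "v = (g ^^ i) u" by (auto simp: r_def)
      then have "u = (g ^^ (i * m - i)) v" using pow_back by simp
      then show "(v, u) \<in> r" using uv by (auto simp: r_def)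
    qed
    show "trans r"
    proof (rule transI)
      fix u v w assume "(u, v) \<in> r" "(v, w) \<in> r"
      then obtain i j where *: "u \<in> W" "w \<in> W" "v = (g ^^ i) u" "w = (g ^^ j) v" by (auto simp: r_def)
      then have "w = (g ^^ (j + i)) u" by (simp add: funpow_add)
      then show "(u, w) \<in> r" using * by (auto simp: r_def)
    qed
  qed
  define B where "B = W // r"
  have B_cases: "\<exists>w\<in>W. b = r `` {w}" if "b \<in> B" for b
    using that unfolding B_def by (auto elim: quotientE)
  have card_B: "card b = m" if "b \<in> B" for b
  proof -
    obtain w where w: "w \<in> W" "b = r `` {w}" using B_cases[OF \<open>b \<in> B\<close>] by blast
    have "b = (\<lambda>i. (g ^^ i) w) ` {..<m}"
    proof
      show "b \<subseteq> (\<lambda>i. (g ^^ i) w) ` {..<m}"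
      proof
        fix v assume "v \<in> b"
        then obtain i where v: "v = (g ^^ i) w" using w by (auto simp: r_def)
        have "(g ^^ i) w = (g ^^ (i mod m + m * (i div m))) w" by simp
        also have "\<dots> = (g ^^ (i mod m)) ((g ^^ (m * (i div m))) w)" by (simp only: funpow_add comp_apply)
        also have "(g ^^ (m * (i div m))) w = w" using period[OF w(1)] by simp
        finally show "v \<in> (\<lambda>i. (g ^^ i) w) ` {..<m}" using v m by auto
      qed
      show "(\<lambda>i. (g ^^ i) w) ` {..<m} \<subseteq> b" using w pow_in by (auto simp: r_def)
    qed
    moreover have "inj_on (\<lambda>i. (g ^^ i) w) {..<m}"
    proof (rule linorder_inj_onI)
      fix i j assume ij: "i < j" "i \<in> {..<m}" "j \<in> {..<m}"
      show "(g ^^ i) w \<noteq> (g ^^ j) w"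
      proof
        assume "(g ^^ i) w = (g ^^ j) w"
        also have "(g ^^ j) w = (g ^^ (i + (j - i))) w" using ij by simp
        also have "\<dots> = (g ^^ i) ((g ^^ (j - i)) w)" by (simp only: funpow_add comp_apply)
        finally have "w = (g ^^ (j - i)) w"
          using pow_bij[of i] w(1) pow_in by (auto simp: bij_betw_def inj_on_def)
        then have "m dvd j - i" using period[OF w(1), of "j - i"] by simp
        then show False using ij by (auto dest: dvd_imp_le)
      qed
    qed auto
    ultimately show ?thesis by (simp add: card_image)
  qed
  have union_B: "\<Union>B = W" unfolding B_def by (rule Union_quotient[OF eq])
  have disj: "b \<inter> b' = {}" if "b \<in> B" "b' \<in> B" "b \<noteq> b'" for b b'
    using quotient_disj[OF eq] that unfolding B_def by blast
  have finB: "finite B" using fin union_B finite_UnionD by blast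
  have finb: "finite b" if "b \<in> B" for b using fin union_B that by (meson Union_upper finite_subset)
  have neb: "b \<noteq> {}" if "b \<in> B" for b using card_B[OF that] m by auto
  have "m * card B = card W"
    using card_partition[of B m] finB fin union_B card_B disj by simp
  then have card_quot: "card W div m = card B" using m by (metis div_mult_self1_is_m)
  have card_Union: "card (\<Union>X) = m * card X" if "X \<subseteq> B" for X
  proof -
    have "finite X" using that finB finite_subset by blast
    then show ?thesis using card_partition[of X m] that finb card_B disj by (simp add: subset_iff)
  qed
  have g_block: "g ` b = b" if "b \<in> B" for b
  proof -
    obtain w where w: "w \<in> W" "b = r `` {w}" using B_cases[OF \<open>b \<in> B\<close>] by blast
    have "g ` b \<subseteq> b"
    proof
      fix v assume "v \<in> g ` b"
      then obtain i where v: "v = g ((g ^^ i) w)" using w by (auto simp: r_def)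
      then have "v = (g ^^ Suc i) w" by simp
      moreover have "(g ^^ Suc i) w \<in> W" by (rule pow_in[OF w(1)])
      ultimately show "v \<in> b" using w unfolding r_def by blast
    qed
    moreover have "b \<subseteq> W" using that union_B by blast
    then have "inj_on g b" using g by (meson bij_betw_imp_inj_on inj_on_subset)
    ultimately show ?thesis using finb[OF that] by (simp add: endo_inj_surj)
  qed
  have bij: "bij_betw Union {X. X \<subseteq> B \<and> m * card X = k} (stable_subsets g W k)"
  proof (rule bij_betw_byWitness[where f' = "\<lambda>S. {b \<in> B. b \<subseteq> S}"])
    show "\<forall>X\<in>{X. X \<subseteq> B \<and> m * card X = k}. {b \<in> B. b \<subseteq> \<Union>X} = X"
    proof clarify
      fix X assume "X \<subseteq> B"
      have "b \<in> X" if "b \<in> B" "b \<subseteq> \<Union>X" for b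
      proof -
        obtain w where "w \<in> b" using neb[OF \<open>b \<in> B\<close>] by blast
        then obtain b' where "b' \<in> X" "w \<in> b'" using \<open>b \<subseteq> \<Union>X\<close> by blast
        then show ?thesis using disj[of b b'] that \<open>w \<in> b\<close> \<open>X \<subseteq> B\<close> by blast
      qed
      then show "{b \<in> B. b \<subseteq> \<Union>X} = X" using \<open>X \<subseteq> B\<close> by blast
    qed
    have un: "\<Union>{b \<in> B. b \<subseteq> S} = S" if S: "S \<in> stable_subsets g W k" for S
    proof
      have gS: "g ` S = S" "S \<subseteq> W" using S by (auto simp: stable_subsets_def)
      have powS: "(g ^^ i) w \<in> S" if "w \<in> S" for i w
        by (induction i) (use that gS in auto)
      show "S \<subseteq> \<Union>{b \<in> B. b \<subseteq> S}"
      proof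
        fix w assume w: "w \<in> S"
        then have "w \<in> W" using gS by blast
        then have "r `` {w} \<in> B" "w \<in> r `` {w}"
          using equiv_class_self[OF eq] by (auto simp: B_def quotientI)
        moreover have "r `` {w} \<subseteq> S" using powS[OF w] by (auto simp: r_def)
        ultimately show "w \<in> \<Union>{b \<in> B. b \<subseteq> S}" by blast
      qed
    qed blast
    then show "\<forall>S\<in>stable_subsets g W k. \<Union>{b \<in> B. b \<subseteq> S} = S" by blast
    show "Union ` {X. X \<subseteq> B \<and> m * card X = k} \<subseteq> stable_subsets g W k"
    proof clarify
      fix X assume X: "X \<subseteq> B" "k = m * card X"
      have "g ` \<Union>X = (\<Union>b\<in>X. g ` b)" by blast
      also have "\<dots> = (\<Union>b\<in>X. b)" using g_block X(1) by (intro SUP_cong) auto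
      finally have "g ` \<Union>X = \<Union>X" by simp
      then show "\<Union>X \<in> stable_subsets g W (m * card X)"
        using X union_B card_Union[OF X(1)] by (auto simp: stable_subsets_def)
    qed
    show "(\<lambda>S. {b \<in> B. b \<subseteq> S}) ` stable_subsets g W k \<subseteq> {X. X \<subseteq> B \<and> m * card X = k}"
    proof (rule image_subsetI)
      fix S assume S: "S \<in> stable_subsets g W k"
      have "m * card {b \<in> B. b \<subseteq> S} = card S"
        using card_Union[of "{b \<in> B. b \<subseteq> S}"] un[OF S] by simp
      then show "{b \<in> B. b \<subseteq> S} \<in> {X. X \<subseteq> B \<and> m * card X = k}"
        using S by (auto simp: stable_subsets_def)
    qed
  qed
  show ?thesis
  proof (cases "m dvd k")
    case True
    then have "{X. X \<subseteq> B \<and> m * card X = k} = {X. X \<subseteq> B \<and> card X = k div m}"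
      using m by auto
    then show ?thesis using True bij_betw_same_card[OF bij] n_subsets[OF finB] card_quot by simp
  next
    case False
    then have empty: "{X. X \<subseteq> B \<and> m * card X = k} = {}" by auto
    show ?thesis using False bij_betw_same_card[OF bij] unfolding empty by simp
  qed
qed

text \<open>A stable set splits uniquely into its stable parts in \<open>A\<close> and
  \<open>B\<close>; the index \<open>j\<close> is the size of the part in \<open>A\<close>. This
  allows different cycle lengths on the two sets.\<close>

lemma card_stable_subsets_Un:
  assumes fin: "finite A" "finite B" and disj: "A \<inter> B = {}"
    and g: "g ` A \<subseteq> A" "g ` B \<subseteq> B"
  shows "card (stable_subsets g (A \<union> B) k) =
    (\<Sum>j\<le>k. card (stable_subsets g A j) * card (stable_subsets g B (k - j)))"
proof -
  let ?P = "SIGMA j:{..k}. stable_subsets g A j \<times> stable_subsets g B (k - j)"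
  have split: "g ` (S \<inter> A) = S \<inter> A" "g ` (S \<inter> B) = S \<inter> B" if "g ` S = S" "S \<subseteq> A \<union> B" for S
    using that disj g by blast+
  have "bij_betw (\<lambda>(j, S, T). S \<union> T) ?P (stable_subsets g (A \<union> B) k)"
  proof (rule bij_betw_byWitness[where f' = "\<lambda>S. (card (S \<inter> A), S \<inter> A, S \<inter> B)"])
    have "(S \<union> T) \<inter> A = S" "(S \<union> T) \<inter> B = T" if "S \<subseteq> A" "T \<subseteq> B" for S T
      using that disj by blast+
    then show "\<forall>x\<in>?P. (\<lambda>S. (card (S \<inter> A), S \<inter> A, S \<inter> B)) ((\<lambda>(j, S, T). S \<union> T) x) = x"
      by (auto simp: stable_subsets_def)
    show "\<forall>S\<in>stable_subsets g (A \<union> B) k. (\<lambda>(j, S, T). S \<union> T) (card (S \<inter> A), S \<inter> A, S \<inter> B) = S"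
      by (auto simp: stable_subsets_def)
    show "(\<lambda>(j, S, T). S \<union> T) ` ?P \<subseteq> stable_subsets g (A \<union> B) k"
    proof clarify
      fix j S T assume j: "j \<le> k" and S: "S \<in> stable_subsets g A j" and T: "T \<in> stable_subsets g B (k - j)"
      have "finite S" "finite T" "S \<inter> T = {}"
        using S T fin disj by (auto simp: stable_subsets_def intro: finite_subset)
      then have "card (S \<union> T) = k" using S T j by (simp add: card_Un_disjoint stable_subsets_def)
      then show "S \<union> T \<in> stable_subsets g (A \<union> B) k"
        using S T by (auto simp: stable_subsets_def image_Un)
    qed
    show "(\<lambda>S. (card (S \<inter> A), S \<inter> A, S \<inter> B)) ` stable_subsets g (A \<union> B) k \<subseteq> ?P"
    proof (rule image_subsetI)
      fix S assume S: "S \<in> stable_subsets g (A \<union> B) k"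
      then have S': "S \<subseteq> A \<union> B" "card S = k" "g ` S = S" by (auto simp: stable_subsets_def)
      have "S = (S \<inter> A) \<union> (S \<inter> B)" using S' by blast
      then have "k = card ((S \<inter> A) \<union> (S \<inter> B))" using S' by simp
      also have "\<dots> = card (S \<inter> A) + card (S \<inter> B)"
        using fin disj by (intro card_Un_disjoint) auto
      finally show "(card (S \<inter> A), S \<inter> A, S \<inter> B) \<in> ?P"
        using split[OF S'(3,1)] by (auto simp: stable_subsets_def)
    qed
  qed
  then have "card (stable_subsets g (A \<union> B) k) = card ?P" by (simp add: bij_betw_same_card)
  also have "\<dots> = (\<Sum>j\<le>k. card (stable_subsets g A j \<times> stable_subsets g B (k - j)))"
    using fin by (intro card_SigmaI) (auto simp: finite_stable_subsets)
  finally show ?thesis by (simp add: card_cartesian_product)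
qed


section \<open>Orbits of the affine group\<close>

context prime_modulus
begin

text \<open>The pair \<open>(a, b)\<close> stands for the affine map x \<mapsto> a x + b, and the
  product is composition. Through \<open>aut\<close> this map acts on the reflections, while the
  rotations see only the multiplier \<open>a\<close>.\<close>

definition agl :: "(int \<times> int) monoid" where
  "agl = \<lparr>carrier = (Zp - {0}) \<times> Zp,
    monoid.mult = (\<lambda>(a, b) (c, d). ((a * c) mod int p, (a * d + b) mod int p)), one = (1, 0)\<rparr>"

lemma nonzero_Zp_not_dvd: "c \<in> Zp - {0} \<Longrightarrow> \<not> int p dvd c"
  using Zp_eq_iff[of c 0] by simp

lemma mod_nonzero_Zp: "\<not> int p dvd c \<Longrightarrow> c mod int p \<in> Zp - {0}"
  by (simp add: dvd_eq_mod_eq_0)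

lemma mult_mod_nonzero_Zp:
  assumes "a \<in> Zp - {0}" "c \<in> Zp - {0}"
  shows "(a * c) mod int p \<in> Zp - {0}"
  using assms[THEN nonzero_Zp_not_dvd] prime_dvd_mult_iff[OF prime_int_p] by (intro mod_nonzero_Zp) blast

lemma affine_comp_mod:
  "(a * c mod int p * x + (a * d + b) mod int p) mod int p = (a * ((c * x + d) mod int p) + b) mod int p"
proof -
  have "(a * c mod int p * x + (a * d + b) mod int p) mod int p = (a * c * x + (a * d + b)) mod int p"
    by (rule mod_add_cong) (simp_all add: mod_mult_left_eq)
  also have "\<dots> = (a * (c * x + d) + b) mod int p" by (simp add: algebra_simps)
  also have "\<dots> = (a * ((c * x + d) mod int p) + b) mod int p"
    by (metis mod_add_left_eq mod_mult_right_eq)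
  finally show ?thesis .
qed

lemma group_agl: "group agl"
proof (rule groupI)
  fix x y assume "x \<in> carrier agl" "y \<in> carrier agl"
  then show "x \<otimes>\<^bsub>agl\<^esub> y \<in> carrier agl"
    using mult_mod_nonzero_Zp[of "fst x" "fst y"] by (auto simp: agl_def)
next
  show "\<one>\<^bsub>agl\<^esub> \<in> carrier agl" by (simp add: agl_def)
next
  fix x y z assume "x \<in> carrier agl" "y \<in> carrier agl" "z \<in> carrier agl"
  then show "x \<otimes>\<^bsub>agl\<^esub> y \<otimes>\<^bsub>agl\<^esub> z = x \<otimes>\<^bsub>agl\<^esub> (y \<otimes>\<^bsub>agl\<^esub> z)"
    using affine_comp_mod by (auto simp: agl_def mod_simps mult.assoc)
next
  fix x assume "x \<in> carrier agl"
  then show "\<one>\<^bsub>agl\<^esub> \<otimes>\<^bsub>agl\<^esub> x = x" by (auto simp: agl_def Zp_mod)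
next
  fix x assume "x \<in> carrier agl"
  then obtain a b where x: "x = (a, b)" "a \<in> Zp - {0}" "b \<in> Zp" by (auto simp: agl_def)
  obtain u where u: "[a * u = 1] (mod int p)" using inverse_mod[OF nonzero_Zp_not_dvd[OF x(2)]] .
  have "\<not> int p dvd u"
  proof
    assume "int p dvd u"
    then have "[a * u = 0] (mod int p)" by (simp add: cong_0_iff)
    then have "[1 = 0] (mod int p)" using u by (metis cong_sym cong_trans)
    then show False using p_gt_1 by (simp add: cong_0_iff)
  qed
  \<comment> \<open>With \<open>u\<close> inverse to \<open>a\<close>, the inverse of x \<mapsto> a
    x + b is x \<mapsto> u x - u b.\<close>
  then have "(u mod int p, (- (u * b)) mod int p) \<in> carrier agl"
    using mod_nonzero_Zp by (simp add: agl_def)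
  moreover have "(u mod int p, (- (u * b)) mod int p) \<otimes>\<^bsub>agl\<^esub> x = \<one>\<^bsub>agl\<^esub>"
  proof -
    have "(u mod int p * a) mod int p = (a * u) mod int p" by (simp add: mod_simps mult.commute)
    also have "\<dots> = 1" using u p_gt_1 by (simp add: cong_def)
    finally have 1: "(u mod int p * a) mod int p = 1" .
    have "(u mod int p * b + (- (u * b)) mod int p) mod int p = (u * b + - (u * b)) mod int p"
      by (rule mod_add_cong) (simp_all add: mod_mult_left_eq)
    then show ?thesis using 1 by (simp add: agl_def x(1))
  qed
  ultimately show "\<exists>y\<in>carrier agl. y \<otimes>\<^bsub>agl\<^esub> x = \<one>\<^bsub>agl\<^esub>" by blast
qed

text \<open>The non-identity elements, among which connection sets are chosen;
  \<open>(0, False)\<close> encodes the identity.\<close>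

definition W :: "(int \<times> bool) set" where "W = V - {(0, False)}"

lemma finite_W [simp]: "finite W"
  by (simp add: W_def)

lemma card_W: "card W = 2 * p - 1"
proof -
  have "(0, False) \<in> (V :: (int \<times> bool) set)" by simp
  moreover have "card (V :: (int \<times> bool) set) = p * 2" by (simp add: V_def card_cartesian_product)
  ultimately show ?thesis unfolding W_def by (simp add: card_Diff_singleton)
qed

lemma inj_on_aut:
  assumes "\<not> int p dvd c"
  shows "inj_on (aut c d) V"
proof (rule inj_onI)
  fix u v :: "int \<times> bool" assume "u \<in> V" "v \<in> V" and eq: "aut c d u = aut c d v"
  then obtain x a y b where uv: "u = (x, a)" "v = (y, b)" "x \<in> Zp" "y \<in> Zp" by (auto simp: V_def)
  have "a = b" using eq uv by (simp add: aut_def)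
  have "int p dvd (c * x + (if a then d else 0)) - (c * y + (if a then d else 0))"
    using eq uv \<open>a = b\<close> unfolding mod_eq_dvd_iff[symmetric] by (simp add: aut_def)
  then have "int p dvd c * (x - y)" by (simp add: algebra_simps)
  then have "int p dvd x - y" using assms by (simp add: prime_dvd_mult_iff[OF prime_int_p])
  then show "u = v" using uv Zp_eq_iff \<open>a = b\<close> by simp
qed

lemma aut_in_W:
  assumes "\<not> int p dvd c" "v \<in> W"
  shows "aut c d v \<in> W"
  using assms aut_eq_0_iff[OF assms(1), of v d] by (auto simp: W_def)

lemma bij_betw_aut:
  assumes "\<not> int p dvd c"
  shows "bij_betw (aut c d) W W"
proof -
  have "inj_on (aut c d) W" using inj_on_aut[OF assms] by (rule inj_on_subset) (auto simp: W_def)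
  moreover have "aut c d ` W \<subseteq> W" using aut_in_W[OF assms] by blast
  ultimately show ?thesis by (simp add: bij_betw_def endo_inj_surj)
qed

section \<open>The action on connection sets of size \<open>k\<close>\<close>

definition k_subsets :: "nat \<Rightarrow> (int \<times> bool) set set" where
  "k_subsets k = {S. S \<subseteq> W \<and> card S = k}"

definition agl_act :: "nat \<Rightarrow> int \<times> int \<Rightarrow> (int \<times> bool) set \<Rightarrow> (int \<times> bool) set" where
  "agl_act k g = restrict (\<lambda>S. aut (fst g) (snd g) ` S) (k_subsets k)"

lemma finite_k_subsets [simp]: "finite (k_subsets k)"
  by (rule finite_subset[of _ "Pow W"]) (auto simp: k_subsets_def)

lemma aut_image_k_subsets:
  assumes "\<not> int p dvd c" "S \<in> k_subsets k"
  shows "aut c d ` S \<in> k_subsets k"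
proof -
  have "inj_on (aut c d) S"
    using assms(2) by (intro inj_on_subset[OF inj_on_aut[OF assms(1)]]) (auto simp: W_def k_subsets_def)
  then show ?thesis using assms aut_in_W by (auto simp: k_subsets_def card_image)
qed

lemma group_action_agl: "group_action agl (k_subsets k) (agl_act k)"
  unfolding agl_act_def
proof (rule group_action_restrict[OF group_agl])
  fix g S assume g: "g \<in> carrier agl" and S: "S \<in> k_subsets k"
  have "\<not> int p dvd fst g" using g nonzero_Zp_not_dvd by (auto simp: agl_def)
  then show "aut (fst g) (snd g) ` S \<in> k_subsets k" using S by (rule aut_image_k_subsets)
next
  fix S assume "S \<in> k_subsets k"
  then have "aut 1 0 v = v" if "v \<in> S" for v
    using that by (cases v) (auto simp: k_subsets_def W_def aut_def Zp_mod)
  then show "aut (fst \<one>\<^bsub>agl\<^esub>) (snd \<one>\<^bsub>agl\<^esub>) ` S = S" by (simp add: agl_def)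
next
  fix g h S assume "g \<in> carrier agl" "h \<in> carrier agl" "S \<in> k_subsets k"
  have "aut (fst (g \<otimes>\<^bsub>agl\<^esub> h)) (snd (g \<otimes>\<^bsub>agl\<^esub> h)) v = aut (fst g) (snd g) (aut (fst h) (snd h) v)" for v
  proof -
    obtain a b c d where gh: "g = (a, b)" "h = (c, d)" by fastforce
    obtain x t where v: "v = (x, t)" by fastforce
    have 1: "(a * c mod int p * x) mod int p = (a * (c * x mod int p)) mod int p"
      by (simp add: mod_simps mult.assoc)
    note 2 = affine_comp_mod[of a c x d b]
    show ?thesis using 1 2 by (cases t) (simp_all only: gh v agl_def aut_def monoid.simps prod.case fst_conv snd_conv if_True if_False add_0_right)
  qed
  then show "aut (fst (g \<otimes>\<^bsub>agl\<^esub> h)) (snd (g \<otimes>\<^bsub>agl\<^esub> h)) ` S = aut (fst g) (snd g) ` aut (fst h) (snd h) ` S"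
    by (simp add: image_image)
qed

lemma burnside_agl:
  "card (orbits agl (k_subsets k) (agl_act k)) * (p * (p - 1)) =
    (\<Sum>c\<in>Zp - {0}. \<Sum>d\<in>Zp. card (stable_subsets (aut c d) W k))"
proof -
  interpret group_action agl "k_subsets k" "agl_act k" by (rule group_action_agl)
  have fin: "finite (carrier agl)" by (simp add: agl_def)
  have ord: "order agl = p * (p - 1)"
    by (simp add: order_def agl_def card_cartesian_product mult.commute)
  have "invariants (k_subsets k) (agl_act k) (c, d) = stable_subsets (aut c d) W k" for c d
    by (auto simp: invariants_def agl_act_def k_subsets_def stable_subsets_def)
  then have "(\<Sum>g\<in>carrier agl. card (invariants (k_subsets k) (agl_act k) g)) =
      (\<Sum>(c, d)\<in>(Zp - {0}) \<times> Zp. card (stable_subsets (aut c d) W k))"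
    by (intro sum.cong) (auto simp: agl_def)
  then show ?thesis using burnside[OF fin finite_k_subsets] ord by (simp add: sum.cartesian_product)
qed

section \<open>Connection sets fixed by a single affine map\<close>

lemma stable_subsets_id:
  "card (stable_subsets (aut 1 0) W k) = (2 * p - 1) choose k"
proof -
  have "aut 1 0 v = v" if "v \<in> W" for v using that by (cases v) (auto simp: W_def aut_def Zp_mod)
  then have "(aut 1 0 ^^ i) v = v" if "v \<in> W" for i v using that by (induction i) auto
  then show ?thesis
    using card_stable_subsets_uniform[of W "aut 1 0" 1 k] bij_betw_aut[of 1 0] p_gt_1 card_W by simp
qed

text \<open>The \<open>p - 1\<close> rotations are fixed pointwise and the \<open>p\<close>
  reflections form one cycle, so a stable set contains either none or all of the
  reflections.\<close>

lemma stable_subsets_translation: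
  assumes d: "d \<in> Zp - {0}"
  shows "card (stable_subsets (aut 1 d) W k) =
    ((p - 1) choose k) + (if p \<le> k then (p - 1) choose (k - p) else 0)"
proof -
  let ?A = "(Zp - {0}) \<times> {False}" and ?B = "Zp \<times> {True}"
  have W: "W = ?A \<union> ?B" by (auto simp: W_def V_def)
  have fixA: "aut 1 d v = v" if "v \<in> ?A" for v using that by (auto simp: aut_def Zp_mod)
  have "(aut 1 d ^^ i) v = v" if "v \<in> ?A" for i v by (induction i) (use fixA that in auto)
  moreover have "bij_betw (aut 1 d) ?A ?A"
    using fixA by (intro bij_betw_byWitness[where f' = "aut 1 d"]) auto
  ultimately have A: "card (stable_subsets (aut 1 d) ?A j) = (p - 1) choose j" for j
    using card_stable_subsets_uniform[of ?A "aut 1 d" 1 j] by (simp add: card_cartesian_product)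
  have B_sub: "aut 1 d ` ?B \<subseteq> ?B" by (auto simp: aut_def)
  have powB: "(aut 1 d ^^ i) (x, True) = ((x + int i * d) mod int p, True)" if "x \<in> Zp" for i x
    by (induction i) (use that in \<open>auto simp: aut_def Zp_mod mod_simps algebra_simps\<close>)
  have "(aut 1 d ^^ i) v = v \<longleftrightarrow> p dvd i" if vB: "v \<in> ?B" for v i
  proof -
    obtain x where x: "v = (x, True)" "x \<in> Zp" using vB by auto
    have "(aut 1 d ^^ i) v = v \<longleftrightarrow> (x + int i * d) mod int p = x mod int p"
      using x powB by (simp add: Zp_mod)
    also have "\<dots> \<longleftrightarrow> int p dvd int i * d" by (simp add: mod_eq_dvd_iff)
    also have "\<dots> \<longleftrightarrow> p dvd i"
      using nonzero_Zp_not_dvd[OF d] by (simp add: prime_dvd_mult_iff[OF prime_int_p])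
    finally show ?thesis .
  qed
  moreover have "bij_betw (aut 1 d) ?B ?B"
  proof -
    have "inj_on (aut 1 d) ?B" using p_gt_1 by (intro inj_on_subset[OF inj_on_aut]) auto
    then show ?thesis using B_sub by (simp add: bij_betw_def endo_inj_surj)
  qed
  ultimately have B: "card (stable_subsets (aut 1 d) ?B j) = (if p dvd j then 1 choose (j div p) else 0)" for j
    using card_stable_subsets_uniform[of ?B "aut 1 d" p j] p_gt_1 by (simp add: card_cartesian_product)
  have B': "card (stable_subsets (aut 1 d) ?B j) = (if j = 0 \<or> j = p then 1 else 0)" for j
  proof (cases "p dvd j")
    case True
    then obtain q where q: "j = p * q" by blast
    consider "q = 0" | "q = 1" | "q \<ge> 2" by linarith
    then show ?thesis using p_gt_1 unfolding B q by cases (auto simp: binomial_eq_0)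
  next
    case False
    then have "j \<noteq> 0" "j \<noteq> p" by (metis dvd_0_right, metis dvd_refl)
    then show ?thesis unfolding B using False by simp
  qed
  have "card (stable_subsets (aut 1 d) W k) = (\<Sum>j\<le>k. ((p - 1) choose j) * (if k - j = 0 \<or> k - j = p then 1 else 0))"
    unfolding W by (subst card_stable_subsets_Un) (use fixA B_sub in \<open>auto simp: A B'\<close>)
  \<comment> \<open>Within \<open>j \<le> k\<close>, the truncated difference vanishes only for
    \<open>j = k\<close>; \<open>p > 0\<close> keeps this index apart from
    \<open>k - p\<close>.\<close>
  also have "\<dots> = (\<Sum>j\<le>k. (if j = k then (p - 1) choose j else 0) + (if p \<le> k \<and> j = k - p then (p - 1) choose j else 0))"
    using p_gt_1 by (intro sum.cong) auto
  also have "\<dots> = ((p - 1) choose k) + (if p \<le> k then (p - 1) choose (k - p) else 0)"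
    by (simp add: sum.distrib)
  finally show ?thesis .
qed

text \<open>The number of stable \<open>k\<close>-subsets of a set of \<open>2 * (p - 1)\<close>
  points on which all cycles have length \<open>m\<close>, for \<open>m\<close> a divisor of
  \<open>p - 1\<close>.\<close>

definition cycle_choose :: "nat \<Rightarrow> nat \<Rightarrow> nat" where
  "cycle_choose m k = (if m dvd k then (2 * (p - 1) div m) choose (k div m) else 0)"

lemma pow_eq_1_iff_ord:
  assumes "c \<in> Zp - {0}"
  shows "int p dvd c ^ i - 1 \<longleftrightarrow> ord p (nat c) dvd i"
proof -
  have "c = int (nat c)" using assms by (simp add: Zp_def)
  then have "int p dvd c ^ i - 1 \<longleftrightarrow> [int (nat c ^ i) = int 1] (mod int p)"
    by (simp add: cong_iff_dvd_diff)
  also have "\<dots> \<longleftrightarrow> ord p (nat c) dvd i" by (simp only: cong_int_iff ord_divides)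
  finally show ?thesis .
qed

text \<open>The map x \<mapsto> c x + d has one fixed point \<open>z\<close>. Apart from the
  reflection \<open>(z, True)\<close>, all \<open>2 * (p - 1)\<close> elements lie in cycles whose
  length is the order of \<open>c\<close>; the two summands count the stable sets without and with
  that reflection. For \<open>k = 0\<close> the truncated \<open>k - 1\<close> would count the empty
  set twice.\<close>

lemma stable_subsets_dilation:
  assumes c: "c \<in> Zp - {0, 1}" and k: "k \<ge> 1"
  shows "card (stable_subsets (aut c d) W k) =
    cycle_choose (ord p (nat c)) k + cycle_choose (ord p (nat c)) (k - 1)"
proof -
  define m where "m = ord p (nat c)"
  have c0: "c \<in> Zp - {0}" using c by auto
  note ndvd = nonzero_Zp_not_dvd[OF c0]
  have ord: "int p dvd c ^ i - 1 \<longleftrightarrow> m dvd i" for i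
    unfolding m_def by (rule pow_eq_1_iff_ord[OF c0])
  have "coprime p (nat c)"
  proof -
    have "\<not> p dvd nat c" using ndvd c0 by (simp add: Zp_def) (metis int_dvd_int_iff int_nat_eq)
    then show ?thesis using prime_p by (simp add: prime_imp_coprime)
  qed
  then have m: "m > 0" by (simp add: m_def)
  have "\<not> int p dvd 1 - c" using c Zp_eq_iff[of 1 c] by simp
  \<comment> \<open>Solving z (1 - c) = d for the fixed point of the affine map.\<close>
  then obtain n where n: "(0 + int n * (1 - c)) mod int p = d mod int p" using affine_solve by metis
  define z where "z = int n mod int p"
  have z: "z \<in> Zp" by (simp add: z_def)
  have "[z * (1 - c) = int n * (1 - c)] (mod int p)" unfolding z_def by (intro cong_mult) auto
  also have "[int n * (1 - c) = d] (mod int p)" using n by (simp add: cong_def)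
  finally have "[d = z * (1 - c)] (mod int p)" by (rule cong_sym)
  then obtain q where q: "d = z * (1 - c) + int p * q" 
    by (metis add.commute cong_iff_lin cong_sym mult.commute)
  \<comment> \<open>In coordinates centred at \<open>z\<close> the map is multiplication by
    \<open>c\<close>, which makes its iterates explicit.\<close>
  have step: "aut c d (x, True) = ((z + c * (x - z)) mod int p, True)" for x
  proof -
    have "c * x + d = (z + c * (x - z)) + int p * q" by (simp add: q algebra_simps)
    then show ?thesis by (simp add: aut_def)
  qed
  have powF: "(aut c d ^^ i) (x, False) = ((c ^ i * x) mod int p, False)" if "x \<in> Zp" for i x
    by (induction i) (use that in \<open>auto simp: aut_def Zp_mod mod_simps algebra_simps\<close>)
  have powT: "(aut c d ^^ i) (x, True) = ((z + c ^ i * (x - z)) mod int p, True)" if "x \<in> Zp" for i x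
  proof (induction i)
    case 0
    then show ?case using that by (simp add: Zp_mod)
  next
    case (Suc i)
    have "(z + c * ((z + c ^ i * (x - z)) mod int p - z)) mod int p
       = (z + c * (z + c ^ i * (x - z) - z)) mod int p"
      by (intro mod_add_cong mod_mult_cong mod_diff_cong refl) simp_all
    then show ?case using Suc by (simp add: step algebra_simps)
  qed
  let ?B = "{(z, True)}" and ?A = "W - {(z, True)}"
  have zW: "(z, True) \<in> W" using z by (simp add: W_def)
  have fixz: "aut c d (z, True) = (z, True)" using z by (simp add: step Zp_mod)
  have bijA: "bij_betw (aut c d) ?A ?A"
    using bij_betw_DiffI[OF bij_betw_aut[OF ndvd, of d], of ?B ?B] fixz zW by (simp add: bij_betw_def)
  have periodA: "(aut c d ^^ i) v = v \<longleftrightarrow> m dvd i" if v: "v \<in> ?A" for v i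
  proof -
    obtain x b where xb: "v = (x, b)" "x \<in> Zp" using v by (auto simp: W_def V_def)
    show ?thesis
    proof (cases b)
      case True
      have xz: "\<not> int p dvd x - z" using v xb True Zp_eq_iff[OF xb(2) z] by auto
      have "(aut c d ^^ i) v = v \<longleftrightarrow> (z + c ^ i * (x - z)) mod int p = x mod int p"
        using xb True powT by (simp add: Zp_mod)
      also have "\<dots> \<longleftrightarrow> int p dvd (c ^ i - 1) * (x - z)" by (simp add: mod_eq_dvd_iff algebra_simps)
      finally show ?thesis using xz by (simp add: prime_dvd_mult_iff[OF prime_int_p] ord)
    next
      case False
      have x0: "\<not> int p dvd x" using v xb False Zp_eq_iff[OF xb(2) zero_in_Zp] by (auto simp: W_def)
      have "(aut c d ^^ i) v = v \<longleftrightarrow> (c ^ i * x) mod int p = x mod int p"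
        using xb False powF by (simp add: Zp_mod)
      also have "\<dots> \<longleftrightarrow> int p dvd (c ^ i - 1) * x" by (simp add: mod_eq_dvd_iff algebra_simps)
      finally show ?thesis using x0 by (simp add: prime_dvd_mult_iff[OF prime_int_p] ord)
    qed
  qed
  have cardA: "card ?A = 2 * (p - 1)" using zW card_W by (simp add: card_Diff_singleton)
  have A: "card (stable_subsets (aut c d) ?A j) = cycle_choose m j" for j
    using card_stable_subsets_uniform[OF _ bijA m periodA, of j] cardA by (simp add: cycle_choose_def)
  have "(aut c d ^^ i) (z, True) = (z, True)" for i by (induction i) (simp_all add: fixz)
  then have B: "card (stable_subsets (aut c d) ?B j) = 1 choose j" for j
    using card_stable_subsets_uniform[of ?B "aut c d" 1 j] fixz by (simp add: bij_betw_def)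
  have "W = ?A \<union> ?B" using zW by blast
  then have "card (stable_subsets (aut c d) W k) = card (stable_subsets (aut c d) (?A \<union> ?B) k)" by simp
  also have "\<dots> = (\<Sum>j\<le>k. cycle_choose m j * (1 choose (k - j)))"
    using bijA fixz by (subst card_stable_subsets_Un) (auto simp: A B bij_betw_def)
  also have "\<dots> = (\<Sum>j\<in>{k - 1, k}. cycle_choose m j * (1 choose (k - j)))"
    by (rule sum.mono_neutral_right) (auto simp: binomial_eq_0)
  also have "\<dots> = cycle_choose m k + cycle_choose m (k - 1)" using k by (simp)
  finally show ?thesis by (simp add: m_def)
qed

section \<open>Summation over the affine group\<close>

text \<open>The multiplicative group modulo \<open>p\<close> is cyclic of order
  \<open>p - 1\<close>, so it has \<open>totient m\<close> elements of each order \<open>m\<close>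
  dividing \<open>p - 1\<close>.\<close>

lemma sum_by_order:
  fixes h :: "nat \<Rightarrow> nat"
  shows "(\<Sum>c\<in>Zp - {0}. h (ord p (nat c))) = (\<Sum>m | m dvd p - 1. totient m * h m)"
proof -
  have p1: "p > 1" using p_gt_1 by simp
  have "bij_betw nat (Zp - {0}) (totatives p)"
    by (rule bij_betw_byWitness[where f' = int]) (auto simp: Zp_def totatives_prime[OF prime_p])
  then have "(\<Sum>c\<in>Zp - {0}. h (ord p (nat c))) = (\<Sum>c\<in>totatives p. h (ord p c))"
    by (rule sum.reindex_bij_betw)
  also have "\<dots> = (\<Sum>m | m dvd p - 1. \<Sum>c | c \<in> totatives p \<and> ord p c = m. h (ord p c))"
  proof (rule sum.group[symmetric])
    show "finite {m. m dvd p - 1}" using p1 by (simp add: finite_divisors_nat)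
    show "ord p ` totatives p \<subseteq> {m. m dvd p - 1}"
      using order_divides_totient[of p] prime_p
      by (auto simp: totatives_def totient_prime coprime_commute)
  qed simp
  also have "\<dots> = (\<Sum>m | m dvd p - 1. totient m * h m)"
    using prime_card_elements_with_ord_eq_totient[OF p1 prime_p] by (intro sum.cong) auto
  finally show ?thesis .
qed

lemma sum_cycle_choose:
  "(\<Sum>m | m dvd p - 1. totient m * cycle_choose m k) =
    (\<Sum>m | m dvd gcd (p - 1) k. totient m * ((2 * (p - 1) div m) choose (k div m)))"
proof -
  have "finite {m. m dvd p - 1}" using p_gt_1 by (simp add: finite_divisors_nat)
  then have "(\<Sum>m | m dvd gcd (p - 1) k. totient m * ((2 * (p - 1) div m) choose (k div m))) =
    (\<Sum>m | m dvd p - 1. totient m * cycle_choose m k)"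
    by (intro sum.mono_neutral_cong_left) (auto simp: cycle_choose_def)
  then show ?thesis by simp
qed

text \<open>In the Burnside sum the row \<open>c = 1\<close> consists of the identity and
  \<open>p - 1\<close> translations, while every other row is constant in \<open>d\<close>.
  Completing the other rows by the missing order-one term \<open>H 1 = C\<close> turns them into a
  sum over all divisors of \<open>p - 1\<close>; this completion is the source of the negative
  binomial.\<close>

theorem card_orbits:
  assumes k: "k \<ge> 1"
  shows "real (card (orbits agl (k_subsets k) (agl_act k))) =
    1 / real p * (real ((p - 1) choose k) + (if p \<le> k then real ((p - 1) choose (k - p)) else 0)
      - real ((2 * p - 1) choose k)) + M1 p k"
proof -
  define N where "N = card (orbits agl (k_subsets k) (agl_act k))"
  define C where "C = (2 * p - 1) choose k"
  define D where "D = ((p - 1) choose k) + (if p \<le> k then (p - 1) choose (k - p) else 0)"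
  define H where "H m = cycle_choose m k + cycle_choose m (k - 1)" for m
  define s where "s = (\<Sum>m | m dvd p - 1. totient m * H m)"
  have p1: "p > 1" using p_gt_1 by simp
  have "(\<Sum>d\<in>Zp. card (stable_subsets (aut 1 d) W k)) =
      card (stable_subsets (aut 1 0) W k) + (\<Sum>d\<in>Zp - {0}. card (stable_subsets (aut 1 d) W k))"
    by (rule sum.remove) auto
  also have "\<dots> = C + (p - 1) * D"
    by (simp add: stable_subsets_id stable_subsets_translation C_def D_def)
  finally have row1: "(\<Sum>d\<in>Zp. card (stable_subsets (aut 1 d) W k)) = C + (p - 1) * D" .
  \<comment> \<open>Pascal's rule, which needs \<open>k \<ge> 1\<close>.\<close>
  have "H 1 = C"
  proof -
    obtain j where j: "k = Suc j" using k by (cases k) auto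
    have "2 * p - 1 = Suc (2 * (p - 1))" using p1 by simp
    then show ?thesis by (simp add: H_def cycle_choose_def C_def j)
  qed
  have "N * (p * (p - 1)) = (\<Sum>c\<in>Zp - {0}. \<Sum>d\<in>Zp. card (stable_subsets (aut c d) W k))"
    unfolding N_def by (rule burnside_agl)
  also have "\<dots> = (\<Sum>d\<in>Zp. card (stable_subsets (aut 1 d) W k)) +
      (\<Sum>c\<in>Zp - {0} - {1}. \<Sum>d\<in>Zp. card (stable_subsets (aut c d) W k))"
    by (rule sum.remove) auto
  also have "(\<Sum>c\<in>Zp - {0} - {1}. \<Sum>d\<in>Zp. card (stable_subsets (aut c d) W k)) =
      (\<Sum>c\<in>Zp - {0} - {1}. p * H (ord p (nat c)))"
    using k by (intro sum.cong) (simp_all add: stable_subsets_dilation H_def)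
  finally have N: "N * (p * (p - 1)) = C + (p - 1) * D + p * (\<Sum>c\<in>Zp - {0} - {1}. H (ord p (nat c)))"
    by (simp add: row1 sum_distrib_left)
  have "s = (\<Sum>c\<in>Zp - {0}. H (ord p (nat c)))" by (simp add: s_def sum_by_order)
  also have "\<dots> = H (ord p (nat 1)) + (\<Sum>c\<in>Zp - {0} - {1}. H (ord p (nat c)))"
    by (rule sum.remove) auto
  finally have s: "s = C + (\<Sum>c\<in>Zp - {0} - {1}. H (ord p (nat c)))" using \<open>H 1 = C\<close> by simp
  \<comment> \<open>Adding \<open>p * C\<close> to both sides supplies the missing term without
    subtraction of natural numbers.\<close>
  have "N * (p * (p - 1)) + p * C = C + (p - 1) * D + p * s"
    unfolding N s by (simp add: distrib_left)
  then have "real (N * (p * (p - 1)) + p * C) = real (C + (p - 1) * D + p * s)" by (rule arg_cong)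
  then have eq: "real N * (real p * (real p - 1)) + real p * real C =
      real C + (real p - 1) * real D + real p * real s"
    using p1 by (simp add: of_nat_diff)
  have M1: "M1 p k = real s / (real p - 1)"
  proof -
    have "s = (\<Sum>m | m dvd gcd (p - 1) k. totient m * ((2 * (p - 1) div m) choose (k div m))) +
      (\<Sum>m | m dvd gcd (p - 1) (k - 1). totient m * ((2 * (p - 1) div m) choose ((k - 1) div m)))"
      unfolding s_def H_def by (simp only: distrib_left sum.distrib sum_cycle_choose)
    then show ?thesis using p1 by (simp add: M1_def of_nat_diff)
  qed
  have "real p > 0" "real p - 1 > 0" using p1 by auto
  then have "real N = 1 / real p * (real D - real C) + real s / (real p - 1)"
    using eq by (simp add: field_simps)
  then show ?thesis by (simp add: N_def M1 D_def C_def)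
qed

end


section \<open>Dihedral Cayley digraphs\<close>

text \<open>Arcs are pairs of vertices, so the vertex map determines the arc map of an
  isomorphism.\<close>

lemma digraph_iso_cayley_digraph_iff:
  fixes G (structure)
  shows "digraph_iso (cayley_digraph G S) (cayley_digraph G T) \<longleftrightarrow>
    (\<exists>f. bij_betw f (carrier G) (carrier G) \<and>
      (\<forall>g\<in>carrier G. \<forall>h\<in>carrier G. h \<otimes> inv g \<in> S \<longleftrightarrow> f h \<otimes> inv (f g) \<in> T))"
    (is "?L \<longleftrightarrow> ?R")
proof
  let ?X = "cayley_digraph G S" and ?Y = "cayley_digraph G T"
  assume ?L
  then obtain hom where hom: "pre_digraph.digraph_isomorphism ?X hom" and Y: "?Y = app_iso hom ?X"
    by (auto simp: digraph_iso_def)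
  let ?f = "iso_verts hom"
  have inj: "inj_on ?f (carrier G)"
    using hom by (simp add: pre_digraph.digraph_isomorphism_def cayley_digraph_def)
  have "carrier G = ?f ` carrier G"
    using arg_cong[OF Y, of verts] by (simp add: cayley_digraph_def)
  then have bij: "bij_betw ?f (carrier G) (carrier G)" using inj by (simp add: bij_betw_def)
  \<comment> \<open>\<open>app_iso\<close> takes its projections from the isomorphism, so equality
    of the digraphs as records forces them to be \<open>fst\<close> and \<open>snd\<close>.\<close>
  have tail_head: "iso_tail hom = fst" "iso_head hom = snd"
    using arg_cong[OF Y, of tail] arg_cong[OF Y, of head] by (simp_all add: cayley_digraph_def)
  have arcsY: "arcs ?Y = iso_arcs hom ` arcs ?X"
    using arg_cong[OF Y, of arcs] by simp
  have arc_image: "iso_arcs hom (g, h) = (?f g, ?f h)" if "(g, h) \<in> arcs ?X" for g h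
    using hom that tail_head
    by (auto simp: pre_digraph.digraph_isomorphism_def cayley_digraph_def prod_eq_iff)
  have "h \<otimes> inv g \<in> S \<longleftrightarrow> ?f h \<otimes> inv (?f g) \<in> T" if gh: "g \<in> carrier G" "h \<in> carrier G" for g h
  proof -
    have "h \<otimes> inv g \<in> S \<longleftrightarrow> (g, h) \<in> arcs ?X" using gh by (simp add: cayley_digraph_def)
    also have "\<dots> \<longleftrightarrow> (?f g, ?f h) \<in> arcs ?Y"
    proof
      assume "(g, h) \<in> arcs ?X"
      then show "(?f g, ?f h) \<in> arcs ?Y" using arc_image arcsY by (metis imageI)
    next
      assume "(?f g, ?f h) \<in> arcs ?Y"
      then obtain g' h' where *: "(g', h') \<in> arcs ?X" "(?f g, ?f h) = (?f g', ?f h')"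
        using arc_image arcsY by fastforce
      then have "g' \<in> carrier G" "h' \<in> carrier G" by (auto simp: cayley_digraph_def)
      then show "(g, h) \<in> arcs ?X" using * gh inj by (auto simp: inj_on_eq_iff)
    qed
    also have "\<dots> \<longleftrightarrow> ?f h \<otimes> inv (?f g) \<in> T"
      using gh bij bij_betwE by (fastforce simp: cayley_digraph_def)
    finally show ?thesis .
  qed
  then show ?R using bij by blast
next
  let ?X = "cayley_digraph G S" and ?Y = "cayley_digraph G T"
  assume ?R
  then obtain f where bij: "bij_betw f (carrier G) (carrier G)"
    and f: "\<And>g h. g \<in> carrier G \<Longrightarrow> h \<in> carrier G \<Longrightarrow> h \<otimes> inv g \<in> S \<longleftrightarrow> f h \<otimes> inv (f g) \<in> T"
    by blast
  define hom where "hom = \<lparr>iso_verts = f, iso_arcs = (\<lambda>(g, h). (f g, f h)), iso_head = snd, iso_tail = fst\<rparr>"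
  have inj: "inj_on f (carrier G)" and surj: "f ` carrier G = carrier G"
    using bij by (auto simp: bij_betw_def)
  have "inj_on (\<lambda>(g, h). (f g, f h)) (arcs ?X)"
    using inj by (auto simp: inj_on_def cayley_digraph_def)
  then have "pre_digraph.digraph_isomorphism ?X hom"
    using inj wf_cayley_digraph[of G S]
    by (auto simp: pre_digraph.digraph_isomorphism_def hom_def cayley_digraph_def)
  moreover have "?Y = app_iso hom ?X"
  proof -
    have "arcs ?Y \<subseteq> (\<lambda>(g, h). (f g, f h)) ` arcs ?X"
    proof clarify
      fix g' h' assume "(g', h') \<in> arcs ?Y"
      then have *: "g' \<in> carrier G" "h' \<in> carrier G" "h' \<otimes> inv g' \<in> T" by (auto simp: cayley_digraph_def)
      then obtain g h where gh: "g \<in> carrier G" "h \<in> carrier G" "g' = f g" "h' = f h"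
        using surj by (metis imageE)
      then have "(g, h) \<in> arcs ?X" using * f by (simp add: cayley_digraph_def)
      then show "(g', h') \<in> (\<lambda>(g, h). (f g, f h)) ` arcs ?X" using gh by force
    qed
    moreover have "(\<lambda>(g, h). (f g, f h)) ` arcs ?X \<subseteq> arcs ?Y"
      using f surj by (auto simp: cayley_digraph_def)
    ultimately have "arcs ?Y = (\<lambda>(g, h). (f g, f h)) ` arcs ?X" by blast
    then show ?thesis using surj by (simp add: app_iso_def hom_def cayley_digraph_def)
  qed
  ultimately show ?L by (auto simp: digraph_iso_def)
qed

text \<open>Used to identify the number of isomorphism classes with the number of orbits, both being
  images of the \<open>k\<close>-subsets.\<close>

lemma card_image_same_kernel:
  assumes "\<And>x y. x \<in> A \<Longrightarrow> y \<in> A \<Longrightarrow> f x = f y \<longleftrightarrow> g x = g y"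
  shows "card (f ` A) = card (g ` A)"
proof -
  define h where "h = g \<circ> inv_into A f"
  have h: "h (f x) = g x" if "x \<in> A" for x
    using that assms[of "inv_into A f (f x)" x] by (simp add: h_def f_inv_into_f inv_into_into)
  then have "inj_on h (f ` A)" using assms by (auto simp: inj_on_def)
  moreover have "h ` f ` A = g ` A" using h by (force simp: image_image)
  ultimately show ?thesis by (metis card_image)
qed

context prime_modulus
begin

section \<open>Coordinates on the presented dihedral group\<close>

abbreviation D where "D \<equiv> dihedral_group p"

text \<open>The letter \<sigma> precedes the power of \<tau>, opposite to
  \<open>dihedral_nf\<close>, to agree with the encoding used by \<open>label\<close>.\<close>

definition word_of :: "int \<times> bool \<Rightarrow> dihedral_gen group_word" where
  "word_of v = replicate (if snd v then 1 else 0) (Gen_sigma, True) @ replicate (nat (fst v)) (Gen_tau, True)"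

definition elt :: "int \<times> bool \<Rightarrow> dihedral_gen group_word set" where
  "elt v = word_class (dihedral_relations p) (word_of v)"

lemma dihedral_val_word_of:
  assumes "x \<in> Zp"
  shows "dihedral_val (word_of (x, b)) = ((if b then - x else x), (if b then - 1 else 1))"
  using assms by (simp add: word_of_def dihedral_val_append dihedral_val_replicate Zp_def)

text \<open>With its first component taken modulo \<open>p\<close>, \<open>dihedral_val\<close> is a
  complete invariant: every word equals a normal form, and the value determines that form.
  Identities in the presented group thus become arithmetic.\<close>

lemma word_class_dihedral_eq_iff:
  "word_class (dihedral_relations p) u = word_class (dihedral_relations p) w \<longleftrightarrow>
    [fst (dihedral_val u) = fst (dihedral_val w)] (mod int p) \<and> snd (dihedral_val u) = snd (dihedral_val w)"
    (is "?L \<longleftrightarrow> ?R")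
proof
  assume ?L
  then show ?R using dihedral_val_word_eq by (simp add: word_class_eq_iff)
next
  assume R: ?R
  have p0: "p > 0" using p_gt_1 by simp
  have nf: "\<exists>i j. i < p \<and> j < 2 \<and> word_class (dihedral_relations p) u = word_class (dihedral_relations p) (dihedral_nf i j)
    \<and> [fst (dihedral_val u) = int i] (mod int p) \<and> snd (dihedral_val u) = (- 1) ^ j" for u
  proof -
    have "word_class (dihedral_relations p) u \<in> carrier D"
      by (simp add: dihedral_group_def presented_group_simps)
    then have "word_class (dihedral_relations p) u \<in>
        (\<lambda>(i, j). word_class (dihedral_relations p) (dihedral_nf i j)) ` ({..<p} \<times> {..<2})"
      by (simp only: bij_betw_imp_surj_on[OF dihedral_group_bij_betw[OF p0]])
    then obtain i j where ij: "i < p" "j < 2"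
      "word_class (dihedral_relations p) u = word_class (dihedral_relations p) (dihedral_nf i j)"
      by auto
    then have "word_eq (dihedral_relations p) u (dihedral_nf i j)" by (simp add: word_class_eq_iff)
    then show ?thesis using ij dihedral_val_word_eq[of p u "dihedral_nf i j"]
      by (auto simp: dihedral_val_append dihedral_val_replicate)
  qed
  obtain i j where u: "i < p" "j < 2" "word_class (dihedral_relations p) u = word_class (dihedral_relations p) (dihedral_nf i j)"
    "[fst (dihedral_val u) = int i] (mod int p)" "snd (dihedral_val u) = (- 1) ^ j" using nf by blast
  obtain i' j' where w: "i' < p" "j' < 2" "word_class (dihedral_relations p) w = word_class (dihedral_relations p) (dihedral_nf i' j')"
    "[fst (dihedral_val w) = int i'] (mod int p)" "snd (dihedral_val w) = (- 1) ^ j'" using nf by blast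
  have "[int i = int i'] (mod int p)" using u(4) w(4) R by (metis cong_sym cong_trans)
  then have "i = i'" using u(1) w(1) by (simp add: cong_def)
  moreover have "(- 1 :: int) ^ j = (- 1) ^ j'" using R u(5) w(5) by simp
  then have "j = j'" using u(2) w(2) by (auto simp: less_2_cases_iff)
  ultimately show ?L using u(3) w(3) by simp
qed

lemma elt_in_carrier [simp]: "elt v \<in> carrier D"
  by (simp add: elt_def dihedral_group_def presented_group_simps)

lemma bij_betw_elt: "bij_betw elt V (carrier D)"
proof -
  have "inj_on elt V"
  proof (rule inj_onI)
    fix u v assume "u \<in> V" "v \<in> V" and eq: "elt u = elt v"
    then obtain x a y b where uv: "u = (x, a)" "v = (y, b)" "x \<in> Zp" "y \<in> Zp" by (auto simp: V_def)
    have *: "[(if a then - x else x) = (if b then - y else y)] (mod int p)"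
      "(if a then - 1 else 1 :: int) = (if b then - 1 else 1)"
      using eq uv by (simp_all add: elt_def word_class_dihedral_eq_iff dihedral_val_word_of)
    then have "a = b" by (auto split: if_splits)
    moreover have "[x = y] (mod int p)" using *(1) \<open>a = b\<close> by (auto simp: cong_minus_minus_iff split: if_splits)
    then have "x = y" using uv by (simp add: cong_def Zp_mod)
    ultimately show "u = v" using uv by simp
  qed
  moreover have "elt ` V = carrier D"
  proof (rule card_subset_eq)
    have p0: "p > 0" using p_gt_1 by simp
    show "finite (carrier D)" by (rule finite_carrier_dihedral_group[OF p0])
    have "card (elt ` V) = p * 2"
      using \<open>inj_on elt V\<close> by (simp add: card_image V_def card_cartesian_product)
    then show "card (elt ` V) = card (carrier D)"
      using order_dihedral_group[OF p0] by (simp add: order_def)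
  qed auto
  ultimately show ?thesis by (simp add: bij_betw_def)
qed

lemma elt_one: "\<one>\<^bsub>D\<^esub> = elt (0, False)"
  by (simp add: elt_def word_of_def dihedral_group_def presented_group_simps)

text \<open>The product of \<open>elt (label u v)\<close> and \<open>elt u\<close> is compared with
  \<open>elt v\<close> by their values; cancelling \<open>elt u\<close> on the right avoids
  computing an inverse word.\<close>

lemma elt_label:
  assumes "u \<in> V" "v \<in> V"
  shows "elt v \<otimes>\<^bsub>D\<^esub> inv\<^bsub>D\<^esub> elt u = elt (label u v)"
proof -
  interpret group D by (rule group_dihedral_group)
  obtain x a y b where uv: "u = (x, a)" "v = (y, b)" "x \<in> Zp" "y \<in> Zp" using assms by (auto simp: V_def)
  have "elt (label u v) \<otimes>\<^bsub>D\<^esub> elt u = word_class (dihedral_relations p) (word_of (label u v) @ word_of u)"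
    by (simp add: elt_def dihedral_group_def presented_group_simps)
  also have "\<dots> = elt v"
  proof -
    have val: "dihedral_val (word_of (z mod int p, t)) = ((if t then - (z mod int p) else z mod int p), (if t then - 1 else 1))" for z t
      by (rule dihedral_val_word_of) simp
    have "[- ((y - x) mod int p) - x = - (y - x) - x] (mod int p)"
      by (intro cong_diff cong_refl) (simp only: cong_minus_minus_iff cong_mod_left cong_refl)
    moreover have "[- ((x - y) mod int p) + x = - (x - y) + x] (mod int p)"
      by (intro cong_add cong_refl) (simp only: cong_minus_minus_iff cong_mod_left cong_refl)
    moreover have "[(y - x) mod int p + x = y] (mod int p)"
      "[(x - y) mod int p - x = - y] (mod int p)"
      by (simp_all add: cong_def mod_simps)
    ultimately show ?thesis using uv(3,4) unfolding uv(1,2) elt_def word_class_dihedral_eq_iff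
      by (cases a; cases b) (simp_all add: label_def val dihedral_val_append dihedral_val_word_of)
  qed
  finally have "elt v = elt (label u v) \<otimes>\<^bsub>D\<^esub> elt u" by simp
  then show ?thesis by (simp add: m_assoc)
qed

section \<open>Isomorphism classes as orbits\<close>

lemma digraph_iso_iff_isos:
  assumes S: "S \<subseteq> V" and T: "T \<subseteq> V"
  shows "digraph_iso (cayley_digraph D (elt ` S)) (cayley_digraph D (elt ` T)) \<longleftrightarrow> isos (arc S) (arc T) \<noteq> {}"
proof -
  define e where "e = the_inv_into V elt"
  have inj: "inj_on elt V" and surj: "elt ` V = carrier D" using bij_betw_elt by (auto simp: bij_betw_def)
  have e_elt [simp]: "e (elt v) = v" if "v \<in> V" for v using that inj by (simp add: e_def the_inv_into_f_f)
  have elt_e [simp]: "elt (e g) = g" if "g \<in> carrier D" for g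
    using that inj surj by (simp add: e_def f_the_inv_into_f)
  have e_in [simp]: "e g \<in> V" if "g \<in> carrier D" for g
    using that inj surj by (auto simp: e_def the_inv_into_into)
  have arc: "elt v \<otimes>\<^bsub>D\<^esub> inv\<^bsub>D\<^esub> elt u \<in> elt ` X \<longleftrightarrow> arc X u v" if "u \<in> V" "v \<in> V" "X \<subseteq> V" for u v X
  proof -
    have "label u v \<in> V" by (simp add: label_def)
    then show ?thesis using inj_on_image_mem_iff[OF inj] that by (simp add: elt_label arc_def)
  qed
  show ?thesis unfolding digraph_iso_cayley_digraph_iff
  proof
    assume "\<exists>f. bij_betw f (carrier D) (carrier D) \<and>
      (\<forall>g\<in>carrier D. \<forall>h\<in>carrier D. h \<otimes>\<^bsub>D\<^esub> inv\<^bsub>D\<^esub> g \<in> elt ` S \<longleftrightarrow> f h \<otimes>\<^bsub>D\<^esub> inv\<^bsub>D\<^esub> f g \<in> elt ` T)"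
    then obtain f where f: "bij_betw f (carrier D) (carrier D)"
      and iso: "\<And>g h. g \<in> carrier D \<Longrightarrow> h \<in> carrier D \<Longrightarrow>
        h \<otimes>\<^bsub>D\<^esub> inv\<^bsub>D\<^esub> g \<in> elt ` S \<longleftrightarrow> f h \<otimes>\<^bsub>D\<^esub> inv\<^bsub>D\<^esub> f g \<in> elt ` T" by blast
    define F where "F v = (if v \<in> V then e (f (elt v)) else v)" for v
    have "bij_betw (e \<circ> f \<circ> elt) V V"
      using bij_betw_elt f bij_betw_the_inv_into[OF bij_betw_elt] unfolding e_def
      by (blast intro: bij_betw_trans)
    then have "bij_betw F V V" by (rule bij_betw_cong[THEN iffD1, rotated]) (simp add: F_def)
    then have "F permutes V" by (rule bij_imp_permutes) (simp add: F_def)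
    moreover have "arc S u v \<longleftrightarrow> arc T (F u) (F v)" if uv: "u \<in> V" "v \<in> V" for u v
    proof -
      have fc: "f (elt w) \<in> carrier D" for w using f bij_betwE by fastforce
      have "arc S u v \<longleftrightarrow> f (elt v) \<otimes>\<^bsub>D\<^esub> inv\<^bsub>D\<^esub> f (elt u) \<in> elt ` T"
        using iso[of "elt u" "elt v"] arc[OF uv S] by simp
      also have "\<dots> \<longleftrightarrow> arc T (F u) (F v)"
        using arc[of "F u" "F v" T] T uv fc by (simp add: F_def)
      finally show ?thesis .
    qed
    ultimately have "F \<in> isos (arc S) (arc T)" by (simp add: isos_def)
    then show "isos (arc S) (arc T) \<noteq> {}" by blast
  next
    assume "isos (arc S) (arc T) \<noteq> {}"
    then obtain F where F: "F \<in> isos (arc S) (arc T)" by blast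
    then have perm: "F permutes V" by (simp add: isos_def)
    have "bij_betw (elt \<circ> F \<circ> e) (carrier D) (carrier D)"
      using bij_betw_elt permutes_imp_bij[OF perm] bij_betw_the_inv_into[OF bij_betw_elt] unfolding e_def
      by (blast intro: bij_betw_trans)
    moreover have "h \<otimes>\<^bsub>D\<^esub> inv\<^bsub>D\<^esub> g \<in> elt ` S \<longleftrightarrow>
        (elt \<circ> F \<circ> e) h \<otimes>\<^bsub>D\<^esub> inv\<^bsub>D\<^esub> (elt \<circ> F \<circ> e) g \<in> elt ` T"
      if gh: "g \<in> carrier D" "h \<in> carrier D" for g h
    proof -
      have FV: "F (e g) \<in> V" "F (e h) \<in> V" using gh perm by (simp_all add: permutes_in_image)
      have "h \<otimes>\<^bsub>D\<^esub> inv\<^bsub>D\<^esub> g \<in> elt ` S \<longleftrightarrow> arc S (e g) (e h)"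
        using arc[of "e g" "e h" S] S gh by simp
      also have "\<dots> \<longleftrightarrow> arc T (F (e g)) (F (e h))" using F gh by (simp add: isos_def)
      finally show ?thesis using arc[OF FV T] by simp
    qed
    ultimately show "\<exists>f. bij_betw f (carrier D) (carrier D) \<and>
      (\<forall>g\<in>carrier D. \<forall>h\<in>carrier D. h \<otimes>\<^bsub>D\<^esub> inv\<^bsub>D\<^esub> g \<in> elt ` S \<longleftrightarrow> f h \<otimes>\<^bsub>D\<^esub> inv\<^bsub>D\<^esub> f g \<in> elt ` T)"
      by blast
  qed
qed

text \<open>For all integers \<open>c\<close> and \<open>d\<close> the map respects the group
  multiplication, and so it commutes with forming quotients.\<close>

lemma label_aut: "label (aut c d u) (aut c d v) = aut c d (label u v)"
proof -
  obtain x a y b where uv: "u = (x, a)" "v = (y, b)" by fastforce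
  show ?thesis
    by (cases a; cases b) (simp_all add: uv label_def aut_def mod_simps algebra_simps)
qed

lemma isos_iff_aut:
  assumes "odd p" and S: "S \<in> k_subsets k" and T: "T \<in> k_subsets k"
  shows "isos (arc S) (arc T) \<noteq> {} \<longleftrightarrow> (\<exists>g\<in>carrier agl. agl_act k g S = T)"
proof
  have ST: "S \<subseteq> V - {(0, False)}" "T \<subseteq> V - {(0, False)}" "card S = card T"
    using S T by (auto simp: k_subsets_def W_def)
  have finT: "finite T" using ST(2) by (rule finite_subset) simp
  assume "isos (arc S) (arc T) \<noteq> {}"
  then obtain f where "f \<in> isos (arc S) (arc T)" by blast
  then obtain c d where cd: "\<not> int p dvd c" "\<And>v. v \<in> V \<Longrightarrow> v \<in> S \<longleftrightarrow> aut c d v \<in> T"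
    using isomorphism_imp_aut[OF \<open>odd p\<close> ST] by blast
  have "aut c d ` S \<subseteq> T" using cd(2) ST(1) by blast
  moreover have "card (aut c d ` S) = card T"
    using aut_image_k_subsets[OF cd(1) S, of d] T by (simp add: k_subsets_def)
  ultimately have im: "aut c d ` S = T" using finT by (simp add: card_subset_eq)
  \<comment> \<open>The parameters are reduced to residues in order to obtain an element of
    \<open>agl\<close>.\<close>
  have "aut (c mod int p) (d mod int p) v = aut c d v" for v
  proof -
    have "(c mod int p * fst v + d mod int p) mod int p = (c * fst v + d) mod int p"
      by (rule mod_add_cong) (simp_all add: mod_mult_left_eq)
    then show ?thesis by (simp add: aut_def mod_mult_left_eq)
  qed
  then have "agl_act k (c mod int p, d mod int p) S = T" using S im by (simp add: agl_act_def)
  moreover have "(c mod int p, d mod int p) \<in> carrier agl"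
    using mod_nonzero_Zp[OF cd(1)] by (simp add: agl_def)
  ultimately show "\<exists>g\<in>carrier agl. agl_act k g S = T" by blast
next
  assume "\<exists>g\<in>carrier agl. agl_act k g S = T"
  then obtain c d where c: "c \<in> Zp - {0}" and im: "aut c d ` S = T" using S by (auto simp: agl_def agl_act_def)
  note ndvd = nonzero_Zp_not_dvd[OF c]
  have SV: "S \<subseteq> V" using S by (auto simp: k_subsets_def W_def)
  define F where "F v = (if v \<in> V then aut c d v else v)" for v
  have "inj_on F V" using inj_on_aut[OF ndvd] by (auto simp: F_def inj_on_def)
  moreover have "F ` V \<subseteq> V" by (auto simp: F_def)
  ultimately have "bij_betw F V V" by (simp add: bij_betw_def endo_inj_surj)
  then have "F permutes V" by (rule bij_imp_permutes) (simp add: F_def)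
  moreover have "arc S u v \<longleftrightarrow> arc T (F u) (F v)" if "u \<in> V" "v \<in> V" for u v
  proof -
    have "label u v \<in> V" by (simp add: label_def)
    then have "label u v \<in> S \<longleftrightarrow> aut c d (label u v) \<in> T"
      unfolding im[symmetric] using inj_on_image_mem_iff[OF inj_on_aut[OF ndvd]] SV by blast
    then show ?thesis using that by (simp add: arc_def F_def label_aut)
  qed
  ultimately have "F \<in> isos (arc S) (arc T)" by (simp add: isos_def)
  then show "isos (arc S) (arc T) \<noteq> {}" by blast
qed

lemma cayley_digraphs_eq:
  "cayley_digraphs D k = (\<lambda>S. cayley_digraph D (elt ` S)) ` k_subsets k"
proof
  have inj: "inj_on elt V" and surj: "elt ` V = carrier D" using bij_betw_elt by (auto simp: bij_betw_def)
  have one: "(0, False) \<in> V" by simp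
  show "cayley_digraphs D k \<subseteq> (\<lambda>S. cayley_digraph D (elt ` S)) ` k_subsets k"
  proof
    fix X assume "X \<in> cayley_digraphs D k"
    then obtain S' where S': "X = cayley_digraph D S'" "S' \<subseteq> carrier D" "\<one>\<^bsub>D\<^esub> \<notin> S'" "card S' = k"
      by (auto simp: cayley_digraphs_def)
    then obtain S where S: "S \<subseteq> V" "S' = elt ` S" using surj by (metis subset_image_iff)
    have "inj_on elt S" using inj S(1) by (rule inj_on_subset)
    then have "card S = k" using S' S by (simp add: card_image)
    moreover have "(0, False) \<notin> S" using S' S elt_one by auto
    ultimately have "S \<in> k_subsets k" using S by (auto simp: k_subsets_def W_def)
    then show "X \<in> (\<lambda>S. cayley_digraph D (elt ` S)) ` k_subsets k" using S' S by blast
  qed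
  show "(\<lambda>S. cayley_digraph D (elt ` S)) ` k_subsets k \<subseteq> cayley_digraphs D k"
  proof (rule image_subsetI)
    fix S assume "S \<in> k_subsets k"
    then have S: "S \<subseteq> V" "(0, False) \<notin> S" "card S = k" by (auto simp: k_subsets_def W_def)
    have "inj_on elt S" using inj S(1) by (rule inj_on_subset)
    then have "card (elt ` S) = k" using S by (simp add: card_image)
    moreover have "\<one>\<^bsub>D\<^esub> \<notin> elt ` S"
      using inj_on_image_mem_iff[OF inj one S(1)] S(2) by (simp add: elt_one)
    ultimately show "cayley_digraph D (elt ` S) \<in> cayley_digraphs D k"
      unfolding cayley_digraphs_def using S(1) by auto
  qed
qed

text \<open>Two connection sets have the same isomorphism class exactly when they have the same
  orbit, so the two maps on \<open>k_subsets k\<close> have equally many values.\<close>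

theorem num_dihedral_cayley_eq_card_orbits:
  assumes "odd p"
  shows "num_dihedral_cayley p k = card (orbits agl (k_subsets k) (agl_act k))"
proof -
  interpret group_action agl "k_subsets k" "agl_act k" by (rule group_action_agl)
  let ?A = "cayley_digraphs D k" and ?F = "\<lambda>S. cayley_digraph D (elt ` S)"
  let ?R = "{(X, Y). X \<in> ?A \<and> Y \<in> ?A \<and> digraph_iso X Y}"
  have eq: "equiv ?A ?R"
    by (rule equiv_digraph_iso) (auto simp: cayley_digraphs_def wf_cayley_digraph)
  have classes: "iso_classes ?A = (\<lambda>S. ?R `` {?F S}) ` k_subsets k"
    unfolding iso_classes_def quotient_def by (simp add: cayley_digraphs_eq) blast
  have orbs: "orbits agl (k_subsets k) (agl_act k) = orbit agl (agl_act k) ` k_subsets k"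
    by (auto simp: orbits_def)
  have kernel: "?R `` {?F S} = ?R `` {?F T} \<longleftrightarrow> orbit agl (agl_act k) S = orbit agl (agl_act k) T"
    if ST: "S \<in> k_subsets k" "T \<in> k_subsets k" for S T
  proof -
    have FA: "?F S \<in> ?A" "?F T \<in> ?A" using ST by (auto simp: cayley_digraphs_eq)
    have "?R `` {?F S} = ?R `` {?F T} \<longleftrightarrow> digraph_iso (?F S) (?F T)"
      using eq_equiv_class_iff[OF eq FA] FA by simp
    also have "\<dots> \<longleftrightarrow> isos (arc S) (arc T) \<noteq> {}"
      using ST by (intro digraph_iso_iff_isos) (auto simp: k_subsets_def W_def)
    also have "\<dots> \<longleftrightarrow> T \<in> orbit agl (agl_act k) S"
      by (subst isos_iff_aut[OF assms ST]) (auto simp: orbit_def)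
    also have "\<dots> \<longleftrightarrow> orbit agl (agl_act k) S = orbit agl (agl_act k) T"
    proof
      assume "T \<in> orbit agl (agl_act k) S"
      moreover have "orbit agl (agl_act k) S \<in> orbits agl (k_subsets k) (agl_act k)"
        "orbit agl (agl_act k) T \<in> orbits agl (k_subsets k) (agl_act k)"
        using ST by (auto simp: orbits_def)
      ultimately show "orbit agl (agl_act k) S = orbit agl (agl_act k) T"
        using disjoint_union orbit_refl[OF ST(2)] by blast
    qed (use orbit_refl[OF ST(2)] in simp)
    finally show ?thesis .
  qed
  show ?thesis
    unfolding num_dihedral_cayley_def classes orbs by (rule card_image_same_kernel) (rule kernel)
qed

end

theorem theorem3p6:
  fixes p k :: nat
  assumes "prime p" and "odd p" and "k \<le> 2 * p - 1"
  shows "(k = 0 \<or> k = 2 * p - 1 \<longrightarrow> num_dihedral_cayley p k = 1) \<and>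
    (1 \<le> k \<and> k \<le> p - 1 \<longrightarrow>
      real (num_dihedral_cayley p k) =
        1 / real p * (real ((p - 1) choose k) - real ((2 * p - 1) choose k)) + M1 p k) \<and>
    (p \<le> k \<and> k \<le> 2 * p - 2 \<longrightarrow>
      real (num_dihedral_cayley p k) =
        1 / real p * (real ((p - 1) choose (k - p)) - real ((2 * p - 1) choose k)) + M1 p k)"
proof -
  interpret prime_modulus p by unfold_locales (rule assms(1))
  have p1: "p > 1" using p_gt_1 by simp
  note num = num_dihedral_cayley_eq_card_orbits[OF assms(2)]
  have "num_dihedral_cayley p k = 1" if k: "k = 0 \<or> k = 2 * p - 1"
  proof -
    \<comment> \<open>In both extreme cases there is only one connection set: the empty set or all
      of \<open>W\<close>.\<close>
    have "card (k_subsets k) = card W choose k" unfolding k_subsets_def by (rule n_subsets) simp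
    also have "\<dots> = 1" using k by (auto simp: card_W)
    finally obtain S where "k_subsets k = {S}" by (auto simp: card_1_singleton_iff)
    then have "orbits agl (k_subsets k) (agl_act k) = {orbit agl (agl_act k) S}"
      by (auto simp: orbits_def)
    then show ?thesis by (simp add: num)
  qed
  \<comment> \<open>The two ranges of \<open>k\<close> come from the single orbit formula: below
    \<open>p\<close> the conditional term is absent, from \<open>p\<close> on the binomial with
    lower index \<open>k\<close> vanishes.\<close>
  moreover have "k < p" if "k \<le> p - 1" using that p1 by simp
  moreover have "(p - 1) choose k = 0" if "p \<le> k" using that p1 by (simp add: binomial_eq_0)
  ultimately show ?thesis using p1 card_orbits[of k] unfolding num by auto
qed

end
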